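(* Let $\mathcal{G}$ be a mean-payoff game, let $v$ be one of its vertices, and let $c\in\mathbb{R}$. Then $\mathsf{ASV}(v)>c$ if and only if there exists a play $\pi$ in $\mathcal{G}$ such that $\pi$ is a witness of $\mathsf{ASV}(v)>c$.
   Context: A (bi-weighted) arena $\mathcal{A}=(V,E,\langle V_0,V_1\rangle,w_0,w_1)$ consists of a finite set $V$ of vertices, a set $E\subseteq V\times V$ of edges such that every vertex has at least one outgoing edge, a partition $\langle V_0,V_1\rangle$ of $V$ ($V_i$ is owned by Player $i$), and two weight functions $w_0,w_1:E\to\mathbb{Z}$. A play is an infinite path $\pi=\pi_0\pi_1\dots$ of the arena; a history is a non-empty finite prefix of a play; $w_i(h)$ is the sum of the $w_i$-weights of the edges of a history $h$. Mean-payoff game: the payoff of Player $i\in\{0,1\}$ for a play $\pi$ is $\underline{\mathsf{MP}}_i(\pi)=\liminf_{k\to\infty}\frac1k w_i(\pi_0\dots\pi_k)$. A strategy of Player $i$ is a function mapping each history ending in a vertex $u\in V_i$ to a successor of $u$; $\Sigma_i$ is the set of all strategies of Player $i$. For $v\in V$, $\mathsf{Out}_v(\sigma_0,\sigma_1)$ is the unique play starting in $v$ in which both players follow their strategies. For $\epsilon\ge0$, $\mathsf{BR}_1^{\epsilon}(\sigma_0)=\{\sigma_1\in\Sigma_1\mid \forall v\in V\ \forall\sigma_1'\in\Sigma_1:\ \underline{\mathsf{MP}}_1(\mathsf{Out}_v(\sigma_0,\sigma_1))\ge\underline{\mathsf{MP}}_1(\mathsf{Out}_v(\sigma_0,\sigma_1'))-\epsilon\}$.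 Adversarial Stackelberg value: $\mathsf{ASV}(\sigma_0)(v)=\sup_{\epsilon\ge0,\ \mathsf{BR}_1^{\epsilon}(\sigma_0)\ne\varnothing}\ \inf_{\sigma_1\in\mathsf{BR}_1^{\epsilon}(\sigma_0)}\underline{\mathsf{MP}}_0(\mathsf{Out}_v(\sigma_0,\sigma_1))$ and $\mathsf{ASV}(v)=\sup_{\sigma_0\in\Sigma_0}\mathsf{ASV}(\sigma_0)(v)$. Bad vertices: a vertex $u$ is $(c,d)$-bad if $(c,d)\in\Lambda(u)$, where $\Lambda(u)$ is the set of $(c,d)\in\mathbb{R}^2$ such that there is $\sigma_1\in\Sigma_1$ such that for all $\sigma_0\in\Sigma_0$ the play $\pi=\mathsf{Out}_u(\sigma_0,\sigma_1)$ satisfies $\underline{\mathsf{MP}}_0(\pi)\le c$ and $\underline{\mathsf{MP}}_1(\pi)\ge d$. Witness: a play $\pi$ is a $(c',d)$-witness of $\mathsf{ASV}(v)>c$ if $\pi$ starts in $v$, $(\underline{\mathsf{MP}}_0(\pi),\underline{\mathsf{MP}}_1(\pi))=(c',d)$, $c'>c$, and $\pi$ contains no $(c,d)$-bad vertex. A play is a witness of $\mathsf{ASV}(v)>c$ if it is a $(c',d)$-witness of $\mathsf{ASV}(v)>c$ for some $c',d\in\mathbb{R}$. *)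

theory Defs
  imports "HOL-Library.Extended_Real" "HOL-Library.Liminf_Limsup" "HOL-Library.FuncSet"
begin

datatype player = P0 | P1

record 'v arena_data =
  verts :: "'v set"
  edges :: "('v \<times> 'v) set"
  own :: "player \<Rightarrow> 'v set"
  wt :: "player \<Rightarrow> 'v \<times> 'v \<Rightarrow> int"  (* only the values on edges matter *)

locale arena =
  fixes A :: "'v arena_data"
  assumes finite_verts: "finite (verts A)"
    and edges_subset: "edges A \<subseteq> verts A \<times> verts A"
    and edge_out: "\<And>u. u \<in> verts A \<Longrightarrow> \<exists>u'. (u, u') \<in> edges A"
    and own_Un: "own A P0 \<union> own A P1 = verts A"
    and own_Int: "own A P0 \<inter> own A P1 = {}"

definition plays :: "'v arena_data \<Rightarrow> (nat \<Rightarrow> 'v) set" where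
  "plays A = {\<pi>. \<forall>k. (\<pi> k, \<pi> (Suc k)) \<in> edges A}"

(* The history pi_0 ... pi_k, which has k + 1 vertices and k edges. *)
definition prefix_upto :: "(nat \<Rightarrow> 'v) \<Rightarrow> nat \<Rightarrow> 'v list" where
  "prefix_upto \<pi> k = map \<pi> [0..<Suc k]"

definition histories :: "'v arena_data \<Rightarrow> 'v list set" where
  "histories A = {prefix_upto \<pi> k | \<pi> k. \<pi> \<in> plays A}"

definition hist_weight :: "'v arena_data \<Rightarrow> player \<Rightarrow> 'v list \<Rightarrow> int" where
  "hist_weight A i h = (\<Sum>j<length h - 1. wt A i (h ! j, h ! Suc j))"

(* Taken in the extended reals so that liminf is available; since the weights on the
   finitely many edges are bounded, the payoff of a play is always finite.
   The junk term at k = 0 does not affect the liminf. *)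
definition MP :: "'v arena_data \<Rightarrow> player \<Rightarrow> (nat \<Rightarrow> 'v) \<Rightarrow> ereal" where
  "MP A i \<pi> = liminf (\<lambda>k. ereal (1 / real k * real_of_int (hist_weight A i (prefix_upto \<pi> k))))"

(* Extensional function space: a strategy carries no information outside its domain,
   the histories ending in a vertex of its player. *)
definition strategies :: "'v arena_data \<Rightarrow> player \<Rightarrow> ('v list \<Rightarrow> 'v) set" where
  "strategies A i =
     (\<Pi>\<^sub>E h \<in> {h \<in> histories A. last h \<in> own A i}. {u'. (last h, u') \<in> edges A})"

definition follows :: "'v arena_data \<Rightarrow> player \<Rightarrow> ('v list \<Rightarrow> 'v) \<Rightarrow> (nat \<Rightarrow> 'v) \<Rightarrow> bool" where
  "follows A i \<sigma> \<pi> \<longleftrightarrow> (\<forall>k. \<pi> k \<in> own A i \<longrightarrow> \<pi> (Suc k) = \<sigma> (prefix_upto \<pi> k))"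

definition Out :: "'v arena_data \<Rightarrow> 'v \<Rightarrow> ('v list \<Rightarrow> 'v) \<Rightarrow> ('v list \<Rightarrow> 'v) \<Rightarrow> nat \<Rightarrow> 'v" where
  "Out A v \<sigma>0 \<sigma>1 =
     (THE \<pi>. \<pi> \<in> plays A \<and> \<pi> 0 = v \<and> follows A P0 \<sigma>0 \<pi> \<and> follows A P1 \<sigma>1 \<pi>)"

definition BR1 :: "'v arena_data \<Rightarrow> real \<Rightarrow> ('v list \<Rightarrow> 'v) \<Rightarrow> ('v list \<Rightarrow> 'v) set" where
  "BR1 A \<epsilon> \<sigma>0 = {\<sigma>1 \<in> strategies A P1.
     \<forall>v \<in> verts A. \<forall>\<sigma>1' \<in> strategies A P1.
       MP A P1 (Out A v \<sigma>0 \<sigma>1) \<ge> MP A P1 (Out A v \<sigma>0 \<sigma>1') - ereal \<epsilon>}"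

definition ASV_strat :: "'v arena_data \<Rightarrow> ('v list \<Rightarrow> 'v) \<Rightarrow> 'v \<Rightarrow> ereal" where
  "ASV_strat A \<sigma>0 v =
     (SUP \<epsilon> \<in> {\<epsilon>. \<epsilon> \<ge> 0 \<and> BR1 A \<epsilon> \<sigma>0 \<noteq> {}}. INF \<sigma>1 \<in> BR1 A \<epsilon> \<sigma>0. MP A P0 (Out A v \<sigma>0 \<sigma>1))"

definition ASV :: "'v arena_data \<Rightarrow> 'v \<Rightarrow> ereal" where
  "ASV A v = (SUP \<sigma>0 \<in> strategies A P0. ASV_strat A \<sigma>0 v)"

definition Lambda :: "'v arena_data \<Rightarrow> 'v \<Rightarrow> (real \<times> real) set" where
  "Lambda A u = {(c, d). \<exists>\<sigma>1 \<in> strategies A P1. \<forall>\<sigma>0 \<in> strategies A P0.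
     MP A P0 (Out A u \<sigma>0 \<sigma>1) \<le> ereal c \<and> MP A P1 (Out A u \<sigma>0 \<sigma>1) \<ge> ereal d}"

definition bad :: "'v arena_data \<Rightarrow> real \<Rightarrow> real \<Rightarrow> 'v \<Rightarrow> bool" where
  "bad A c d u \<longleftrightarrow> (c, d) \<in> Lambda A u"

definition cd_witness ::
  "'v arena_data \<Rightarrow> real \<Rightarrow> real \<Rightarrow> 'v \<Rightarrow> real \<Rightarrow> (nat \<Rightarrow> 'v) \<Rightarrow> bool" where
  "cd_witness A c' d v c \<pi> \<longleftrightarrow>
     \<pi> \<in> plays A \<and> \<pi> 0 = v \<and>
     (MP A P0 \<pi>, MP A P1 \<pi>) = (ereal c', ereal d) \<and> c' > c \<and>
     (\<forall>k. \<not> bad A c d (\<pi> k))"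

definition witness :: "'v arena_data \<Rightarrow> 'v \<Rightarrow> real \<Rightarrow> (nat \<Rightarrow> 'v) \<Rightarrow> bool" where
  "witness A v c \<pi> \<longleftrightarrow> (\<exists>c' d. cd_witness A c' d v c \<pi>)"

lemma prefix_upto_0: "prefix_upto \<pi> 0 = [\<pi> 0]"
  by (simp add: prefix_upto_def)

lemma prefix_upto_Suc: "prefix_upto \<pi> (Suc k) = prefix_upto \<pi> k @ [\<pi> (Suc k)]"
  by (simp add: prefix_upto_def)

lemma last_prefix_upto: "last (prefix_upto \<pi> k) = \<pi> k"
  by (simp add: prefix_upto_def)

context arena
begin

lemma path_to_prefix_in_histories:
  assumes "\<And>j. j < k \<Longrightarrow> (\<pi> j, \<pi> (Suc j)) \<in> edges A" and "\<pi> k \<in> verts A"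
  shows "prefix_upto \<pi> k \<in> histories A"
proof -
  define s where "s = (\<lambda>u. SOME u'. (u, u') \<in> edges A)"
  have s: "(u, s u) \<in> edges A" if "u \<in> verts A" for u
    unfolding s_def using edge_out[OF that] by (rule someI_ex)
  define \<rho> where "\<rho> = (\<lambda>n. if n \<le> k then \<pi> n else (s ^^ (n - k)) (\<pi> k))"
  have V: "(s ^^ n) (\<pi> k) \<in> verts A" for n
    by (induction n) (use assms(2) s edges_subset in auto)
  have "(\<rho> n, \<rho> (Suc n)) \<in> edges A" for n
  proof -
    consider "n < k" | "n = k" | "n > k" by linarith
    then show ?thesis
    proof cases
      case 1 then show ?thesis using assms(1) by (simp add: \<rho>_def)
    next
      case 2 then show ?thesis using s[OF assms(2)] by (simp add: \<rho>_def)
    next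
      case 3 then show ?thesis using s[OF V[of "n - k"]] by (simp add: \<rho>_def Suc_diff_le)
    qed
  qed
  then have "\<rho> \<in> plays A" by (simp add: plays_def)
  moreover have "prefix_upto \<rho> k = prefix_upto \<pi> k"
    by (simp add: prefix_upto_def \<rho>_def)
  ultimately show ?thesis unfolding histories_def
    by (intro CollectI exI[of _ \<rho>] exI[of _ k]) simp
qed

lemma ex1_outcome:
  assumes v: "v \<in> verts A" and \<sigma>0: "\<sigma>0 \<in> strategies A P0" and \<sigma>1: "\<sigma>1 \<in> strategies A P1"
  shows "\<exists>!\<pi>. \<pi> \<in> plays A \<and> \<pi> 0 = v \<and> follows A P0 \<sigma>0 \<pi> \<and> follows A P1 \<sigma>1 \<pi>"
proof -
  define nxt where "nxt = (\<lambda>h. if last h \<in> own A P0 then \<sigma>0 h else \<sigma>1 h)"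
  define H where "H = rec_nat [v] (\<lambda>_ h. h @ [nxt h])"
  define \<pi> where "\<pi> = (\<lambda>k. last (H k))"
  have \<pi>0: "\<pi> 0 = v" by (simp add: \<pi>_def H_def)
  have Hp: "H k = prefix_upto \<pi> k" for k
  proof (induction k)
    case 0 show ?case by (simp add: prefix_upto_0 \<pi>_def H_def)
  next
    case (Suc k)
    have "H (Suc k) = H k @ [\<pi> (Suc k)]" by (simp add: \<pi>_def H_def)
    then show ?case using Suc by (simp add: prefix_upto_Suc)
  qed
  have step: "\<pi> (Suc k) = nxt (prefix_upto \<pi> k)" for k
    unfolding Hp[symmetric] by (simp add: \<pi>_def H_def)
  have path: "(\<forall>j<k. (\<pi> j, \<pi> (Suc j)) \<in> edges A) \<and> \<pi> k \<in> verts A" for k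
  proof (induction k)
    case 0 show ?case by (simp add: \<pi>0 v)
  next
    case (Suc k)
    then have h: "prefix_upto \<pi> k \<in> histories A" by (blast intro: path_to_prefix_in_histories)
    have "(\<pi> k, \<pi> (Suc k)) \<in> edges A"
    proof (cases "\<pi> k \<in> own A P0")
      case True
      then show ?thesis using h \<sigma>0 unfolding step strategies_def nxt_def
        by (auto simp: PiE_iff last_prefix_upto)
    next
      case False
      then have "\<pi> k \<in> own A P1" using Suc own_Un by blast
      then show ?thesis using h \<sigma>1 False unfolding step strategies_def nxt_def
        by (auto simp: PiE_iff last_prefix_upto)
    qed
    then show ?case using Suc edges_subset by (auto simp: less_Suc_eq)
  qed
  show ?thesis
  proof (rule ex1I[of _ \<pi>])
    have "\<pi> \<in> plays A" using path by (auto simp: plays_def)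
    moreover have "follows A P0 \<sigma>0 \<pi>"
      unfolding follows_def by (simp add: step nxt_def last_prefix_upto)
    moreover have "follows A P1 \<sigma>1 \<pi>"
      unfolding follows_def using own_Int by (auto simp: step nxt_def last_prefix_upto)
    ultimately show "\<pi> \<in> plays A \<and> \<pi> 0 = v \<and> follows A P0 \<sigma>0 \<pi> \<and> follows A P1 \<sigma>1 \<pi>"
      using \<pi>0 by blast
  next
    fix \<rho> assume \<rho>: "\<rho> \<in> plays A \<and> \<rho> 0 = v \<and> follows A P0 \<sigma>0 \<rho> \<and> follows A P1 \<sigma>1 \<rho>"
    have "prefix_upto \<rho> k = prefix_upto \<pi> k" for k
    proof (induction k)
      case 0 show ?case using \<rho> \<pi>0 by (simp add: prefix_upto_0)
    next
      case (Suc k)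
      have "\<rho> k \<in> verts A" using \<rho> edges_subset by (auto simp: plays_def)
      then have "\<rho> k \<in> own A P0 \<or> \<rho> k \<in> own A P1" using own_Un by blast
      then have "\<rho> (Suc k) = nxt (prefix_upto \<rho> k)"
        using \<rho> own_Int by (auto simp: follows_def nxt_def last_prefix_upto)
      then show ?case using Suc by (simp add: prefix_upto_Suc step)
    qed
    then show "\<rho> = \<pi>" by (metis last_prefix_upto ext)
  qed
qed

end

end

theory Submission
  imports Defs
begin

text \<open>
  If Player 1 can force from \<open>u\<close> that the means of \<open>w\<^sub>1 - d\<close> and of \<open>c - w\<^sub>0\<close> both have a
  nonnegative lim inf, then \<open>u\<close> is \<open>(c, d)\<close>-bad. This objective is prefix independent and closed
  under shuffles, so by induction on the number of edges its opponent is positionally determined: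
  if \<open>u\<close> is not bad, Player 0 can restrict her moves, positionally, so that no remaining run from \<open>u\<close>
  satisfies the objective. There is then even some \<open>\<delta> > 0\<close> such that no remaining run has
  \<open>MP\<^sub>0 \<le> c + \<delta>\<close> and \<open>MP\<^sub>1 \<ge> d - \<delta>\<close>: otherwise there would be, at one vertex, closed walks that are
  good up to every \<open>\<delta>\<close>, and concatenating them with \<open>\<delta>\<close> tending to \<open>0\<close> slowly enough would satisfy the
  objective after all.

  Given a witness, Player 0 therefore follows it and, after a deviation of Player 1, plays the
  positional restriction of the vertex where the deviation happened; with the least of the finitely
  many \<open>\<delta>\<close> as tolerance, every approximate best response gives her more than \<open>c\<close> by a fixed margin.
  Conversely, the outcome of an approximate best response is a witness, since from a bad vertex on it
  Player 1 could switch to the strategy given by badness, which is again an approximate best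
  response but yields at most \<open>c\<close>.
\<close>

section \<open>Runs of finite graphs and mean objectives\<close>

definition runs :: "('v \<times> 'v) set \<Rightarrow> (nat \<Rightarrow> 'v) set" where
  "runs E = {\<pi>. \<forall>k. (\<pi> k, \<pi> (Suc k)) \<in> E}"

definition psum :: "('v \<times> 'v \<Rightarrow> real) \<Rightarrow> (nat \<Rightarrow> 'v) \<Rightarrow> nat \<Rightarrow> real" where
  "psum f \<pi> k = (\<Sum>j<k. f (\<pi> j, \<pi> (Suc j)))"

text \<open>That is, \<open>lim inf psum f \<pi> k / k \<ge> 0\<close>. With the additive constant \<open>C\<close> instead of a threshold
  index, the bounds for two interleaved runs simply add up.\<close>
definition mean_ge0 :: "('v \<times> 'v \<Rightarrow> real) \<Rightarrow> (nat \<Rightarrow> 'v) \<Rightarrow> bool" where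
  "mean_ge0 f \<pi> \<longleftrightarrow> (\<forall>e>0. \<exists>C. \<forall>k. - C - e * real k \<le> psum f \<pi> k)"

definition all_mean_ge0 :: "('v \<times> 'v \<Rightarrow> real) set \<Rightarrow> (nat \<Rightarrow> 'v) \<Rightarrow> bool" where
  "all_mean_ge0 G \<pi> \<longleftrightarrow> (\<forall>f\<in>G. mean_ge0 f \<pi>)"

definition consistent :: "'v set \<Rightarrow> ('v list \<Rightarrow> 'v) \<Rightarrow> (nat \<Rightarrow> 'v) \<Rightarrow> bool" where
  "consistent U \<sigma> \<pi> \<longleftrightarrow> (\<forall>k. \<pi> k \<in> U \<longrightarrow> \<pi> (Suc k) = \<sigma> (prefix_upto \<pi> k))"

definition total_graph :: "'v set \<Rightarrow> ('v \<times> 'v) set \<Rightarrow> bool" where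
  "total_graph V E \<longleftrightarrow> finite V \<and> E \<subseteq> V \<times> V \<and> (\<forall>u\<in>V. \<exists>u'. (u, u') \<in> E)"

text \<open>Legality is required on all lists, so that a strategy cannot win vacuously by leaving
  the graph.\<close>
definition legal :: "'v set \<Rightarrow> ('v \<times> 'v) set \<Rightarrow> ('v list \<Rightarrow> 'v) \<Rightarrow> bool" where
  "legal U E \<sigma> \<longleftrightarrow> (\<forall>h. last h \<in> U \<longrightarrow> (last h, \<sigma> h) \<in> E)"

definition forces ::
  "'v set \<Rightarrow> ('v \<times> 'v) set \<Rightarrow> ('v \<times> 'v \<Rightarrow> real) set \<Rightarrow> 'v \<Rightarrow> bool" where
  "forces U E G u \<longleftrightarrow>
     (\<exists>\<sigma>. legal U E \<sigma> \<and> (\<forall>\<pi>\<in>runs E. \<pi> 0 = u \<longrightarrow> consistent U \<sigma> \<pi> \<longrightarrow> all_mean_ge0 G \<pi>))"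

text \<open>The opponent of the owner of \<open>U\<close> wins positionally: every move that respects \<open>F\<close> will do.\<close>
definition refutes ::
  "'v set \<Rightarrow> 'v set \<Rightarrow> ('v \<times> 'v) set \<Rightarrow> ('v \<times> 'v \<Rightarrow> real) set \<Rightarrow> 'v \<Rightarrow> bool" where
  "refutes V U E G u \<longleftrightarrow>
     (\<exists>F. F \<subseteq> E \<and> total_graph V F \<and> (\<forall>e\<in>E. fst e \<in> U \<longrightarrow> e \<in> F) \<and>
          (\<forall>\<pi>\<in>runs F. \<pi> 0 = u \<longrightarrow> \<not> all_mean_ge0 G \<pi>))"

lemma length_prefix_upto [simp]: "length (prefix_upto \<pi> k) = Suc k"
  by (simp add: prefix_upto_def)

lemma nth_prefix_upto [simp]: "i \<le> k \<Longrightarrow> prefix_upto \<pi> k ! i = \<pi> i"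
  unfolding prefix_upto_def by (subst nth_map) (auto simp del: upt_Suc)

lemma prefix_upto_not_Nil [simp]: "prefix_upto \<pi> k \<noteq> []"
  by (simp add: prefix_upto_def)

lemma hd_prefix_upto [simp]: "hd (prefix_upto \<pi> k) = \<pi> 0"
  by (simp add: hd_conv_nth)

lemma prefix_upto_cong: "(\<And>i. i \<le> k \<Longrightarrow> \<pi> i = \<rho> i) \<Longrightarrow> prefix_upto \<pi> k = prefix_upto \<rho> k"
  by (simp add: prefix_upto_def)

lemma take_prefix_upto: "i \<le> k \<Longrightarrow> take (Suc i) (prefix_upto \<pi> k) = prefix_upto \<pi> i"
  by (rule nth_equalityI) auto

text \<open>Recursion on whole histories: a rule that reads the history so far, such as a strategy,
  prolongs any given prefix. Hence \<open>H\<close> carries the history and not only the current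
  vertex.\<close>

lemma ex_continuation:
  fixes \<pi> :: "nat \<Rightarrow> 'v"
  shows "\<exists>\<rho>. (\<forall>j\<le>n. \<rho> j = \<pi> j) \<and> (\<forall>j\<ge>n. \<rho> (Suc j) = nx (prefix_upto \<rho> j))"
proof -
  define H where "H = rec_nat (prefix_upto \<pi> n) (\<lambda>_ h. h @ [nx h])"
  have H0: "H 0 = prefix_upto \<pi> n" and HS: "H (Suc k) = H k @ [nx (H k)]" for k
    by (simp_all add: H_def)
  define \<rho> where "\<rho> = (\<lambda>j. if j \<le> n then \<pi> j else last (H (j - n)))"
  have p: "prefix_upto \<rho> (n + k) = H k" for k
  proof (induction k)
    case 0
    show ?case by (simp add: H0) (rule prefix_upto_cong, simp add: \<rho>_def)
  next
    case (Suc k)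
    have "\<rho> (Suc (n + k)) = nx (H k)" by (simp add: \<rho>_def Suc_diff_le HS)
    with Suc show ?case by (simp add: prefix_upto_Suc HS)
  qed
  have "\<rho> (Suc j) = nx (prefix_upto \<rho> j)" if "j \<ge> n" for j
  proof -
    from that obtain k where j: "j = n + k" using le_Suc_ex by blast
    have "\<rho> (Suc j) = nx (H k)" by (simp add: \<rho>_def Suc_diff_le HS j)
    then show ?thesis using p[of k] j by simp
  qed
  moreover have "\<forall>j\<le>n. \<rho> j = \<pi> j" by (simp add: \<rho>_def)
  ultimately show ?thesis by blast
qed

section \<open>Partial sums and prefix independence\<close>

lemma psum_Suc: "psum f \<pi> (Suc k) = psum f \<pi> k + f (\<pi> k, \<pi> (Suc k))"
  by (simp add: psum_def)

lemma psum_0 [simp]: "psum f \<pi> 0 = 0"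
  by (simp add: psum_def)

lemma psum_shift: "psum f \<pi> (n + k) = psum f \<pi> n + psum f (\<lambda>j. \<pi> (n + j)) k"
  by (induction k) (simp_all add: psum_Suc)

lemma psum_bound:
  assumes "\<pi> \<in> runs E" "\<And>e. e \<in> E \<Longrightarrow> \<bar>f e\<bar> \<le> B"
  shows "\<bar>psum f \<pi> k\<bar> \<le> B * real k"
proof (induction k)
  case (Suc k)
  have "\<bar>f (\<pi> k, \<pi> (Suc k))\<bar> \<le> B" using assms by (auto simp: runs_def)
  with Suc show ?case by (simp add: psum_Suc algebra_simps)
qed simp

text \<open>Dropping \<open>n\<close> edges changes all later partial sums by the same amount, which
  the constant \<open>C\<close> absorbs.\<close>

lemma mean_ge0_shift: "mean_ge0 f (\<lambda>j. \<pi> (n + j)) \<longleftrightarrow> mean_ge0 f \<pi>"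
proof
  assume L: "mean_ge0 f (\<lambda>j. \<pi> (n + j))"
  show "mean_ge0 f \<pi>" unfolding mean_ge0_def
  proof (intro allI impI)
    fix e :: real assume "e > 0"
    then obtain C where C: "\<And>k. - C - e * real k \<le> psum f (\<lambda>j. \<pi> (n + j)) k"
      using L unfolding mean_ge0_def by blast
    \<comment> \<open>The sum majorizes the partial sums at all times up to \<open>n\<close>, so one
      constant serves both the early times and the shift.\<close>
    define D where "D = \<bar>C\<bar> + (\<Sum>i\<le>n. \<bar>psum f \<pi> i\<bar>)"
    have b: "\<bar>psum f \<pi> i\<bar> \<le> (\<Sum>i\<le>n. \<bar>psum f \<pi> i\<bar>)" if "i \<le> n" for i
      using that by (intro member_le_sum) auto
    have "- D - e * real k \<le> psum f \<pi> k" for k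
    proof (cases "k \<le> n")
      case True
      then show ?thesis using b[OF True] \<open>e > 0\<close> by (simp add: D_def) (smt (verit) mult_nonneg_nonneg of_nat_0_le_iff)
    next
      case False
      then obtain i where i: "k = n + i" using le_Suc_ex nat_le_linear by blast
      have "e * real i \<le> e * real k" using \<open>e > 0\<close> i by simp
      then show ?thesis using C[of i] b[of n] unfolding i psum_shift D_def by simp
    qed
    then show "\<exists>C. \<forall>k. - C - e * real k \<le> psum f \<pi> k" by blast
  qed
next
  assume R: "mean_ge0 f \<pi>"
  show "mean_ge0 f (\<lambda>j. \<pi> (n + j))" unfolding mean_ge0_def
  proof (intro allI impI)
    fix e :: real assume "e > 0"
    then obtain C where C: "\<And>k. - C - e * real k \<le> psum f \<pi> k"
      using R unfolding mean_ge0_def by blast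
    have "- (C + e * real n + psum f \<pi> n) - e * real k \<le> psum f (\<lambda>j. \<pi> (n + j)) k" for k
      using C[of "n + k"] unfolding psum_shift by (simp add: distrib_left)
    then show "\<exists>C. \<forall>k. - C - e * real k \<le> psum f (\<lambda>j. \<pi> (n + j)) k" by blast
  qed
qed

lemma all_mean_ge0_shift: "all_mean_ge0 G (\<lambda>j. \<pi> (n + j)) \<longleftrightarrow> all_mean_ge0 G \<pi>"
  by (simp add: all_mean_ge0_def mean_ge0_shift)

text \<open>For \<open>U = {}\<close> the strategy \<open>\<sigma>\<close> is irrelevant and these are just the paths from \<open>u\<close>.\<close>
definition cpath ::
  "'v set \<Rightarrow> ('v \<times> 'v) set \<Rightarrow> ('v list \<Rightarrow> 'v) \<Rightarrow> 'v \<Rightarrow> 'v list \<Rightarrow> bool" where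
  "cpath U E \<sigma> u h \<longleftrightarrow> h \<noteq> [] \<and> hd h = u \<and>
     (\<forall>i. Suc i < length h \<longrightarrow>
        (h ! i, h ! Suc i) \<in> E \<and> (h ! i \<in> U \<longrightarrow> h ! Suc i = \<sigma> (take (Suc i) h)))"

lemma cpath_singleton: "cpath U E \<sigma> u [u]"
  by (simp add: cpath_def)

lemma cpath_snoc:
  assumes "cpath U E \<sigma> u h" "(last h, y) \<in> E" "last h \<in> U \<Longrightarrow> y = \<sigma> h"
  shows "cpath U E \<sigma> u (h @ [y])"
  unfolding cpath_def
proof (intro conjI allI impI)
  fix i assume "Suc i < length (h @ [y])"
  then consider "Suc i < length h" | "Suc i = length h" by force
  then show "((h @ [y]) ! i, (h @ [y]) ! Suc i) \<in> E"
  proof cases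
    case 2
    then have "i = length h - 1" by simp
    then show ?thesis using assms 2 by (auto simp: nth_append last_conv_nth cpath_def)
  qed (use assms in \<open>auto simp: nth_append cpath_def\<close>)
next
  fix i assume "Suc i < length (h @ [y])" and U: "(h @ [y]) ! i \<in> U"
  then consider "Suc i < length h" | "Suc i = length h" by force
  then show "(h @ [y]) ! Suc i = \<sigma> (take (Suc i) (h @ [y]))"
  proof cases
    case 2
    then have "i = length h - 1" by simp
    then show ?thesis using assms 2 U by (auto simp: nth_append last_conv_nth cpath_def)
  qed (use assms U in \<open>auto simp: nth_append cpath_def\<close>)
qed (use assms in \<open>auto simp: cpath_def\<close>)

text \<open>Pairwise compatible paths have a common infinite extension. The lengths in
  \<open>H\<close> may be bounded; past the longest path the run goes on with moves of
  \<open>\<sigma>\<close> on \<open>U\<close> and arbitrary edges elsewhere, which legality and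
  totality supply.\<close>

lemma ex_limit_run:
  assumes tot: "total_graph V E" and u: "u \<in> V" and leg: "legal U E \<sigma>"
    and H: "\<And>h. h \<in> H \<Longrightarrow> cpath U E \<sigma> u h"
    and comp: "\<And>g h i. \<lbrakk>g \<in> H; h \<in> H; i < length g; i < length h\<rbrakk> \<Longrightarrow> g ! i = h ! i"
  shows "\<exists>\<rho>\<in>runs E. \<rho> 0 = u \<and> consistent U \<sigma> \<rho> \<and> (\<forall>h\<in>H. h = prefix_upto \<rho> (length h - 1))"
proof -
  define dflt where
    "dflt = (\<lambda>g. if last g \<in> U then \<sigma> g else SOME y. (last g, y) \<in> E)"
  \<comment> \<open>Any member of \<open>H\<close> longer than the history gives the next vertex; by
    \<open>comp\<close> all of them give the same one.\<close>
  define nx where "nx = (\<lambda>g. if \<exists>h\<in>H. length g < length h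
       then (SOME h. h \<in> H \<and> length g < length h) ! length g else dflt g)"
  obtain \<rho> where \<rho>0: "\<rho> 0 = u" and \<rho>S: "\<And>j. \<rho> (Suc j) = nx (prefix_upto \<rho> j)"
    using ex_continuation[of 0 "\<lambda>_. u" nx] by auto
  have ag: "\<rho> i = h ! i" if "h \<in> H" "i < length h" for h i
  proof (cases i)
    case 0
    then show ?thesis using H[OF that(1)] \<rho>0 by (auto simp: cpath_def hd_conv_nth)
  next
    case (Suc j)
    define h' where "h' = (SOME h. h \<in> H \<and> Suc j < length h)"
    have h': "h' \<in> H \<and> Suc j < length h'"
      unfolding h'_def using that Suc by (intro someI_ex[where P = "\<lambda>h. h \<in> H \<and> Suc j < length h"]) auto
    have "\<rho> i = h' ! Suc j" using that Suc by (auto simp: \<rho>S nx_def h'_def)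
    then show ?thesis using comp[of h' h "Suc j"] h' that Suc by simp
  qed
  have pre: "take (Suc i) h = prefix_upto \<rho> i" if "h \<in> H" "i < length h" for h i
    using that ag[OF that(1)] by (intro nth_equalityI) auto
  \<comment> \<open>Conditional on \<open>\<rho> i \<in> V\<close>, since membership is proved
    afterwards by an induction that uses this step.\<close>
  have step: "\<rho> i \<in> V \<and> (\<rho> i, \<rho> (Suc i)) \<in> E \<and> (\<rho> i \<in> U \<longrightarrow> \<rho> (Suc i) = \<sigma> (prefix_upto \<rho> i))"
    if V: "\<rho> i \<in> V" for i
  proof (cases "\<exists>h\<in>H. Suc i < length h")
    case True
    then obtain h where h: "h \<in> H" "Suc i < length h" by blast
    have "cpath U E \<sigma> u h" using H h by blast
    then have "(h ! i, h ! Suc i) \<in> E" "h ! i \<in> U \<longrightarrow> h ! Suc i = \<sigma> (take (Suc i) h)"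
      using h unfolding cpath_def by auto
    then show ?thesis using V ag[of h i] ag[of h "Suc i"] pre[of h i] h by auto
  next
    case False
    then have d: "\<rho> (Suc i) = dflt (prefix_upto \<rho> i)" by (simp add: \<rho>S nx_def)
    have "(\<rho> i, SOME y. (\<rho> i, y) \<in> E) \<in> E"
      using tot V unfolding total_graph_def by (metis someI_ex)
    moreover have "(\<rho> i, \<sigma> (prefix_upto \<rho> i)) \<in> E" if "\<rho> i \<in> U"
      using leg that unfolding legal_def by (metis last_prefix_upto)
    ultimately show ?thesis using V by (simp add: d dflt_def last_prefix_upto)
  qed
  have V: "\<rho> i \<in> V" for i
  proof (induction i)
    case 0 then show ?case using u \<rho>0 by simp
  next
    case (Suc i) then show ?case using step[OF Suc] tot unfolding total_graph_def by blast
  qed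
  have "\<rho> \<in> runs E" "consistent U \<sigma> \<rho>"
    using step V unfolding runs_def consistent_def by auto
  moreover have "h = prefix_upto \<rho> (length h - 1)" if "h \<in> H" for h
  proof -
    have "h \<noteq> []" using H[OF that] by (simp add: cpath_def)
    then show ?thesis using pre[OF that, of "length h - 1"] by simp
  qed
  ultimately show ?thesis using \<rho>0 by blast
qed

section \<open>Positional determinacy\<close>

lemma runsD: "\<pi> \<in> runs E \<Longrightarrow> (\<pi> k, \<pi> (Suc k)) \<in> E"
  by (simp add: runs_def)

lemma legalD: "legal U E \<sigma> \<Longrightarrow> last h \<in> U \<Longrightarrow> (last h, \<sigma> h) \<in> E"
  by (simp add: legal_def)

lemma some_successor: "total_graph V E \<Longrightarrow> u \<in> V \<Longrightarrow> (u, SOME y. (u, y) \<in> E) \<in> E"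
  unfolding total_graph_def by (metis someI_ex)

text \<open>Strategies assembled from other data propose edges only on histories that can arise;
  elsewhere an arbitrary successor keeps them legal.\<close>

lemma legal_fallback:
  assumes "total_graph V E" "U \<subseteq> V"
  shows "legal U E (\<lambda>h. if (last h, f h) \<in> E then f h else SOME y. (last h, y) \<in> E)"
  using some_successor[OF assms(1)] assms(2) by (auto simp: legal_def)

text \<open>A strategy that wins in \<open>E1\<close> never reaches \<open>x\<close>, where it would lose; hence the additional
  edges at \<open>x\<close> do not matter.\<close>
lemma forces_of_losing_vertex:
  assumes tot: "total_graph V E" and u: "u \<in> V"
    and sub: "E1 \<subseteq> E" and keep: "\<And>e. e \<in> E \<Longrightarrow> fst e \<noteq> x \<Longrightarrow> e \<in> E1"
    and ref: "refutes V U E1 G x" and forc: "forces U E1 G u"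
  shows "forces U E G u"
proof -
  from forc obtain \<sigma> where leg: "legal U E1 \<sigma>"
    and win: "\<And>\<pi>. \<pi> \<in> runs E1 \<Longrightarrow> \<pi> 0 = u \<Longrightarrow> consistent U \<sigma> \<pi> \<Longrightarrow> all_mean_ge0 G \<pi>"
    unfolding forces_def by blast
  from ref obtain F where F: "F \<subseteq> E1" "total_graph V F" "\<And>e. e \<in> E1 \<Longrightarrow> fst e \<in> U \<Longrightarrow> e \<in> F"
    and lose: "\<And>\<pi>. \<pi> \<in> runs F \<Longrightarrow> \<pi> 0 = x \<Longrightarrow> \<not> all_mean_ge0 G \<pi>"
    unfolding refutes_def by blast
  have leg': "legal U E \<sigma>" using leg sub unfolding legal_def by blast
  have "all_mean_ge0 G \<pi>" if \<pi>: "\<pi> \<in> runs E" "\<pi> 0 = u" "consistent U \<sigma> \<pi>" for \<pi>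
  proof (cases "\<exists>n. \<pi> n = x")
    case False
    then have "\<pi> \<in> runs E1" using \<pi>(1) keep unfolding runs_def by auto
    then show ?thesis using win \<pi> by blast
  next
    case True
    define n where "n = (LEAST n. \<pi> n = x)"
    have n: "\<pi> n = x" unfolding n_def using True by (rule LeastI_ex)
    have before: "\<pi> j \<noteq> x" if "j < n" for j
      using that not_less_Least unfolding n_def by blast
    \<comment> \<open>From the first visit to \<open>x\<close> on, \<open>\<pi>\<close> is replaced:
      \<open>\<sigma>\<close> moves on \<open>U\<close>, the opponent inside \<open>F\<close>. The
      result is a run of \<open>E1\<close> consistent with \<open>\<sigma>\<close>, hence won, but
      its tail from \<open>x\<close> is a run of \<open>F\<close>, hence lost.\<close>
    define nx where "nx = (\<lambda>h. if last h \<in> U then \<sigma> h else SOME y. (last h, y) \<in> F)"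
    obtain \<rho> where \<rho>: "\<And>j. j \<le> n \<Longrightarrow> \<rho> j = \<pi> j"
      and \<rho>S: "\<And>j. j \<ge> n \<Longrightarrow> \<rho> (Suc j) = nx (prefix_upto \<rho> j)"
      using ex_continuation[of n \<pi> nx] by blast
    have "x \<in> V" using n tot \<pi>(1) unfolding total_graph_def runs_def by blast
    have step: "(\<rho> j, \<rho> (Suc j)) \<in> F" if "j \<ge> n" "\<rho> j \<in> V" for j
    proof (cases "\<rho> j \<in> U")
      case True
      then have "(\<rho> j, \<sigma> (prefix_upto \<rho> j)) \<in> E1"
        using legalD[OF leg, of "prefix_upto \<rho> j"] by (simp add: last_prefix_upto)
      then have "(\<rho> j, \<rho> (Suc j)) \<in> E1"
        using \<rho>S[OF that(1)] True by (simp add: nx_def last_prefix_upto)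
      then show ?thesis using F True by simp
    next
      case False
      then have "\<rho> (Suc j) = (SOME y. (\<rho> j, y) \<in> F)"
        using \<rho>S[OF that(1)] by (simp add: nx_def last_prefix_upto)
      then show ?thesis using some_successor[OF F(2) that(2)] by simp
    qed
    have "\<rho> (n + j) \<in> V" for j
    proof (induction j)
      case 0 then show ?case using \<rho>[of n] n \<open>x \<in> V\<close> by simp
    next
      case (Suc j) then show ?case using step[of "n + j"] F(2) unfolding total_graph_def by auto
    qed
    then have stepF: "(\<rho> j, \<rho> (Suc j)) \<in> F" if "j \<ge> n" for j
      using step[OF that] that by (metis le_Suc_ex)
    have "(\<lambda>j. \<rho> (n + j)) \<in> runs F" using stepF unfolding runs_def by simp
    then have no: "\<not> all_mean_ge0 G \<rho>" using lose[of "\<lambda>j. \<rho> (n + j)"] \<rho>[of n] n all_mean_ge0_shift[of G \<rho> n] by simp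
    have "\<rho> \<in> runs E1" unfolding runs_def
    proof (intro CollectI allI)
      fix k show "(\<rho> k, \<rho> (Suc k)) \<in> E1"
      proof (cases "k < n")
        case True
        then show ?thesis using keep[of "(\<pi> k, \<pi> (Suc k))"] before[OF True] \<pi>(1) \<rho>[of k] \<rho>[of "Suc k"]
          by (auto simp: runs_def)
      qed (use stepF F(1) in auto)
    qed
    moreover have "consistent U \<sigma> \<rho>" unfolding consistent_def
    proof (intro allI impI)
      fix k assume k: "\<rho> k \<in> U"
      show "\<rho> (Suc k) = \<sigma> (prefix_upto \<rho> k)"
      proof (cases "k < n")
        case True
        have "prefix_upto \<rho> k = prefix_upto \<pi> k" using True \<rho> by (intro prefix_upto_cong) auto
        then show ?thesis using \<pi>(3) True k \<rho> unfolding consistent_def by (simp add: Suc_leI)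
      next
        case False
        then show ?thesis using k by (simp add: \<rho>S nx_def last_prefix_upto)
      qed
    qed
    ultimately show ?thesis using win no \<rho>[of 0] \<pi>(2) by auto
  qed
  then show ?thesis unfolding forces_def using leg' by blast
qed

definition wsum :: "('v \<times> 'v \<Rightarrow> real) \<Rightarrow> 'v list \<Rightarrow> real" where
  "wsum f h = psum f (\<lambda>i. h ! i) (length h - 1)"

lemma wsum_prefix_upto [simp]: "wsum f (prefix_upto \<pi> k) = psum f \<pi> k"
  by (simp add: wsum_def psum_def)

lemma wsum_singleton [simp]: "wsum f [u] = 0"
  by (simp add: wsum_def)

lemma wsum_snoc:
  assumes "h \<noteq> []"
  shows "wsum f (h @ [y]) = wsum f h + f (last h, y)"
proof -
  obtain n where n: "length h = Suc n" using assms by (cases h) auto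
  then show ?thesis using assms
    by (simp add: wsum_def psum_Suc last_conv_nth nth_append) (simp add: psum_def nth_append)
qed

lemma chain_nth_eq:
  assumes "\<And>k. \<exists>ys. s (Suc k) = s k @ ys" and "i < length (s a)" "i < length (s b)"
  shows "s a ! i = s b ! i"
proof -
  have "\<exists>ys. s (k + n) = s k @ ys" for k n
  proof (induction n)
    case (Suc n)
    then show ?case using assms(1)[of "k + n"] by auto
  qed simp
  then have "s a ! i = s b ! i" if "a \<le> b" "i < length (s a)" "i < length (s b)" for a b
    using that by (metis le_Suc_ex nth_append)
  then show ?thesis using assms(2,3) by (metis nat_le_linear)
qed

lemma ex_limit_chain:
  assumes "total_graph V E" "u \<in> V" "legal U E \<sigma>"
    and s: "\<And>k. cpath U E \<sigma> u (s k)" and mono: "\<And>k. \<exists>ys. s (Suc k) = s k @ ys"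
  shows "\<exists>\<rho>\<in>runs E. \<rho> 0 = u \<and> consistent U \<sigma> \<rho> \<and> (\<forall>k. prefix_upto \<rho> (length (s k) - 1) = s k)"
proof -
  have "\<exists>\<rho>\<in>runs E. \<rho> 0 = u \<and> consistent U \<sigma> \<rho> \<and>
      (\<forall>h\<in>range s. h = prefix_upto \<rho> (length h - 1))"
  proof (rule ex_limit_run[OF assms(1-3)])
    show "cpath U E \<sigma> u h" if "h \<in> range s" for h using that s by auto
    show "g ! i = h ! i" if "g \<in> range s" "h \<in> range s" "i < length g" "i < length h" for g h i
      using that chain_nth_eq[of s, OF mono] by auto
  qed
  then show ?thesis by (metis rangeI)
qed

text \<open>The run is split into two runs, one in \<open>E1\<close> and one in \<open>E2\<close>, which change places only at
  visits to \<open>x\<close>, according to the edge the opponent takes there. The state \<open>(m, g, h)\<close> below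
  records the two histories, and \<open>m\<close> tells that \<open>g\<close> is the one being extended.\<close>
lemma forces_shuffle:
  assumes tot: "total_graph V E" and UV: "U \<subseteq> V" and x: "x \<in> V" "x \<notin> U" and u: "u \<in> V"
    and tot1: "total_graph V E1" and tot2: "total_graph V E2" and un: "E = E1 \<union> E2"
    and keep: "\<And>e. e \<in> E \<Longrightarrow> fst e \<noteq> x \<Longrightarrow> e \<in> E1 \<inter> E2"
    and f1: "forces U E1 G u" and f2: "forces U E2 G x"
  shows "forces U E G u"
proof -
  from f1 obtain \<sigma>1 where leg1: "legal U E1 \<sigma>1"
    and win1: "\<And>\<pi>. \<pi> \<in> runs E1 \<Longrightarrow> \<pi> 0 = u \<Longrightarrow> consistent U \<sigma>1 \<pi> \<Longrightarrow> all_mean_ge0 G \<pi>"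
    unfolding forces_def by blast
  from f2 obtain \<sigma>2 where leg2: "legal U E2 \<sigma>2"
    and win2: "\<And>\<pi>. \<pi> \<in> runs E2 \<Longrightarrow> \<pi> 0 = x \<Longrightarrow> consistent U \<sigma>2 \<pi> \<Longrightarrow> all_mean_ge0 G \<pi>"
    unfolding forces_def by blast
  \<comment> \<open>\<open>z\<close> is the current vertex and \<open>y\<close> the next. At
    \<open>x\<close> the edge taken selects the history to extend; elsewhere the active one stays
    active.\<close>
  define upd where "upd = (\<lambda>z y (m, g, h).
     if (if z = x then (x, y) \<in> E1 else m) then (True, g @ [y], h) else (False, g, h @ [y]))"
  define S where "S = (\<lambda>\<pi>. rec_nat (True, [u], [x]) (\<lambda>k. upd (\<pi> k) (\<pi> (Suc k))))"
  have S0: "S \<pi> 0 = (True, [u], [x])" and SS: "S \<pi> (Suc k) = upd (\<pi> k) (\<pi> (Suc k)) (S \<pi> k)" for \<pi> k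
    by (simp_all add: S_def)
  have Scong: "S \<pi> k = S \<rho> k" if "\<And>i. i \<le> k \<Longrightarrow> \<pi> i = \<rho> i" for \<pi> \<rho> k
    using that by (induction k) (simp_all add: S0 SS)
  define mv where "mv = (\<lambda>(m, g, h). if m then \<sigma>1 g else \<sigma>2 h)"
  \<comment> \<open>The strategy recomputes the state from the history and plays the move of the
    strategy in charge of the active part.\<close>
  define \<sigma> where "\<sigma> = (\<lambda>h. let y = mv (S (\<lambda>i. h ! i) (length h - 1)) in
     if (last h, y) \<in> E then y else SOME y. (last h, y) \<in> E)"
  have leg: "legal U E \<sigma>"
    unfolding \<sigma>_def Let_def using tot UV by (rule legal_fallback)
  have "all_mean_ge0 G \<pi>" if \<pi>: "\<pi> \<in> runs E" "\<pi> 0 = u" "consistent U \<sigma> \<pi>" for \<pi>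
  proof -
    define M where "M = (\<lambda>k. fst (S \<pi> k))"
    define P where "P = (\<lambda>k. fst (snd (S \<pi> k)))"
    define Q where "Q = (\<lambda>k. snd (snd (S \<pi> k)))"
    have SMPQ: "S \<pi> k = (M k, P k, Q k)" for k by (simp add: M_def P_def Q_def)
    define b where "b = (\<lambda>k. if \<pi> k = x then (x, \<pi> (Suc k)) \<in> E1 else M k)"
    have nxt: "M (Suc k) = b k" "P (Suc k) = (if b k then P k @ [\<pi> (Suc k)] else P k)"
      "Q (Suc k) = (if b k then Q k else Q k @ [\<pi> (Suc k)])" for k
      using SS[of \<pi> k] unfolding SMPQ by (simp_all add: upd_def b_def split: if_splits)
    have z: "M 0" "P 0 = [u]" "Q 0 = [x]" using S0[of \<pi>] unfolding SMPQ by simp_all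
    \<comment> \<open>The inactive history always ends in \<open>x\<close>, which makes switching at
      \<open>x\<close> possible. Both start vertices are counted, hence
      \<open>k + 2\<close>.\<close>
    have inv: "cpath U E1 \<sigma>1 u (P k) \<and> cpath U E2 \<sigma>2 x (Q k)
        \<and> last (P k) = (if M k then \<pi> k else x) \<and> last (Q k) = (if M k then x else \<pi> k)
        \<and> length (P k) + length (Q k) = k + 2
        \<and> (\<forall>f. wsum f (P k) + wsum f (Q k) = psum f \<pi> k)" for k
    proof (induction k)
      case 0
      then show ?case by (simp add: z cpath_singleton \<pi>)
    next
      case (Suc k)
      have ne: "P k \<noteq> []" "Q k \<noteq> []" using Suc by (auto simp: cpath_def)
      have wP: "wsum f (P k) + wsum f (Q k) = psum f \<pi> k" for f using Suc by blast
      have ed: "(\<pi> k, \<pi> (Suc k)) \<in> E" using \<pi> by (simp add: runs_def)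
      have e1: "(\<pi> k, \<pi> (Suc k)) \<in> E1" if "b k"
        using that ed keep[of "(\<pi> k, \<pi> (Suc k))"] by (auto simp: b_def split: if_splits)
      have e2: "(\<pi> k, \<pi> (Suc k)) \<in> E2" if "\<not> b k"
        using that ed keep[of "(\<pi> k, \<pi> (Suc k))"] un by (auto simp: b_def split: if_splits)
      have lastP: "last (P k) = \<pi> k" if "b k"
        using Suc that by (auto simp: b_def split: if_splits)
      have lastQ: "last (Q k) = \<pi> k" if "\<not> b k"
        using Suc that by (auto simp: b_def split: if_splits)
      have mvU: "\<pi> (Suc k) = mv (M k, P k, Q k)" if "\<pi> k \<in> U"
      proof -
        have eq: "S (\<lambda>i. prefix_upto \<pi> k ! i) k = S \<pi> k" by (rule Scong) simp
        \<comment> \<open>As \<open>x\<close> is not in \<open>U\<close>, no switch happens at a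
          move of \<open>U\<close>.\<close>
        have bM: "b k = M k" using that x by (auto simp: b_def)
        have "(\<pi> k, mv (M k, P k, Q k)) \<in> E"
        proof (cases "M k")
          case True
          then show ?thesis using legalD[OF leg1, of "P k"] lastP bM that un by (simp add: mv_def)
        next
          case False
          then show ?thesis using legalD[OF leg2, of "Q k"] lastQ bM that un by (simp add: mv_def)
        qed
        then have "\<sigma> (prefix_upto \<pi> k) = mv (M k, P k, Q k)"
          by (simp add: \<sigma>_def Let_def eq SMPQ last_prefix_upto)
        then show ?thesis using \<pi>(3) that by (simp add: consistent_def)
      qed
      show ?case
      proof (cases "b k")
        case True
        have "cpath U E1 \<sigma>1 u (P k @ [\<pi> (Suc k)])"
        proof (rule cpath_snoc)
          assume "last (P k) \<in> U"
          then have "\<pi> k \<in> U" using lastP True by simp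
          moreover from this have "M k" using True x by (auto simp: b_def split: if_splits)
          ultimately show "\<pi> (Suc k) = \<sigma>1 (P k)" using mvU by (simp add: mv_def)
        qed (use Suc e1 lastP True in auto)
        moreover have "last (Q k) = x"
          using Suc True by (auto simp: b_def split: if_splits)
        moreover have "wsum f (P k @ [\<pi> (Suc k)]) + wsum f (Q k) = psum f \<pi> (Suc k)" for f
          using wP[of f] lastP True ne by (simp add: wsum_snoc psum_Suc)
        ultimately show ?thesis using Suc True by (simp add: nxt)
      next
        case False
        have "cpath U E2 \<sigma>2 x (Q k @ [\<pi> (Suc k)])"
        proof (rule cpath_snoc)
          assume "last (Q k) \<in> U"
          then have "\<pi> k \<in> U" using lastQ False by simp
          moreover from this have "\<not> M k" using False x by (auto simp: b_def split: if_splits)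
          ultimately show "\<pi> (Suc k) = \<sigma>2 (Q k)" using mvU by (simp add: mv_def)
        qed (use Suc e2 lastQ False in auto)
        moreover have "last (P k) = x"
          using Suc False by (auto simp: b_def split: if_splits)
        moreover have "wsum f (P k) + wsum f (Q k @ [\<pi> (Suc k)]) = psum f \<pi> (Suc k)" for f
          using wP[of f] lastQ False ne by (simp add: wsum_snoc psum_Suc)
        ultimately show ?thesis using Suc False by (simp add: nxt)
      qed
    qed
    have cP: "cpath U E1 \<sigma>1 u (P k)" and cQ: "cpath U E2 \<sigma>2 x (Q k)"
      and mP: "\<exists>ys. P (Suc k) = P k @ ys" and mQ: "\<exists>ys. Q (Suc k) = Q k @ ys" for k
      using inv[of k] by (simp_all add: nxt)
    \<comment> \<open>One of the two histories may stop growing; its limit run then goes on in its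
      own graph, still consistent with its strategy, and only its prefixes are compared with
      \<open>\<pi>\<close>.\<close>
    obtain \<rho>1 where r1: "\<rho>1 \<in> runs E1" "\<rho>1 0 = u" "consistent U \<sigma>1 \<rho>1"
      and p1: "\<forall>k. prefix_upto \<rho>1 (length (P k) - 1) = P k"
      using ex_limit_chain[where s = P, OF tot1 u leg1 cP mP] by auto
    obtain \<rho>2 where r2: "\<rho>2 \<in> runs E2" "\<rho>2 0 = x" "consistent U \<sigma>2 \<rho>2"
      and p2: "\<forall>k. prefix_upto \<rho>2 (length (Q k) - 1) = Q k"
      using ex_limit_chain[where s = Q, OF tot2 x(1) leg2 cQ mQ] by auto
    have o: "all_mean_ge0 G \<rho>1" "all_mean_ge0 G \<rho>2" using win1[OF r1] win2[OF r2] by auto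
    show "all_mean_ge0 G \<pi>" unfolding all_mean_ge0_def mean_ge0_def
    proof (intro ballI allI impI)
      fix f and e :: real assume "f \<in> G" "e > 0"
      then have "mean_ge0 f \<rho>1" "mean_ge0 f \<rho>2" using o by (auto simp: all_mean_ge0_def)
      then obtain C1 C2 where C: "\<And>k. - C1 - e * real k \<le> psum f \<rho>1 k"
        "\<And>k. - C2 - e * real k \<le> psum f \<rho>2 k"
        using \<open>e > 0\<close> unfolding mean_ge0_def by blast
      have "- (C1 + C2) - e * real k \<le> psum f \<pi> k" for k
      proof -
        define i where "i = length (P k) - 1"
        define j where "j = length (Q k) - 1"
        have "P k \<noteq> []" "Q k \<noteq> []" using inv[of k] by (auto simp: cpath_def)
        then have "length (P k) = Suc i" "length (Q k) = Suc j" by (simp_all add: i_def j_def)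
        then have ij: "i + j = k" using inv[of k] by simp
        have "psum f \<pi> k = psum f \<rho>1 i + psum f \<rho>2 j"
        proof -
          have "wsum f (P k) = psum f \<rho>1 i" "wsum f (Q k) = psum f \<rho>2 j"
            unfolding i_def j_def by (metis p1 wsum_prefix_upto, metis p2 wsum_prefix_upto)
          then show ?thesis using inv[of k] by metis
        qed
        then show ?thesis using C(1)[of i] C(2)[of j] ij[symmetric] by (simp add: algebra_simps)
      qed
      then show "\<exists>C. \<forall>k. - C - e * real k \<le> psum f \<pi> k" by blast
    qed
  qed
  then show ?thesis unfolding forces_def using leg by blast
qed

text \<open>Split the edges at an opponent vertex \<open>x\<close> with a choice. If the opponent
  wins from \<open>x\<close> after committing to one edge, visits to \<open>x\<close> are lost for
  \<open>U\<close>, and the committed game decides the whole one; otherwise \<open>U\<close> has an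
  answer to that edge, and the shuffle reduces the game to the one without it.\<close>

lemma forces_or_refutes:
  assumes "total_graph V E" "U \<subseteq> V" "u \<in> V"
  shows "forces U E G u \<or> refutes V U E G u"
  using assms
proof (induction "card E" arbitrary: E u rule: less_induct)
  case less
  note tot = less.prems(1) and UV = less.prems(2)
  have finE: "finite E" using tot finite_subset unfolding total_graph_def by blast
  show ?case
  proof (cases "\<exists>x a b. x \<in> V - U \<and> (x, a) \<in> E \<and> (x, b) \<in> E \<and> a \<noteq> b")
    case True
    then obtain x a b where x: "x \<in> V" "x \<notin> U" and ab: "(x, a) \<in> E" "(x, b) \<in> E" "a \<noteq> b" by blast
    \<comment> \<open>\<open>E2\<close> commits the opponent at \<open>x\<close> to the edge to
      \<open>a\<close>, and \<open>E1\<close> forbids just that edge. The edge to \<open>b\<close>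
      keeps \<open>E1\<close> total and makes \<open>E2\<close> smaller than
      \<open>E\<close>.\<close>
    define E1 where "E1 = E - {(x, a)}"
    define E2 where "E2 = E - {e. fst e = x \<and> snd e \<noteq> a}"
    have sub: "E1 \<subseteq> E" "E2 \<subseteq> E" unfolding E1_def E2_def by (rule Diff_subset)+
    have succ1: "\<exists>y. (z, y) \<in> E1" and succ2: "\<exists>y. (z, y) \<in> E2" if "z \<in> V" for z
    proof -
      obtain y where y: "(z, y) \<in> E" by (rule that[OF some_successor[OF tot \<open>z \<in> V\<close>]])
      have "(z, if z = x then b else y) \<in> E1" "(z, if z = x then a else y) \<in> E2"
        using y ab by (simp_all add: E1_def E2_def)
      then show "\<exists>y. (z, y) \<in> E1" "\<exists>y. (z, y) \<in> E2" by blast+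
    qed
    have tot1: "total_graph V E1" and tot2: "total_graph V E2"
      using tot sub succ1 succ2 unfolding total_graph_def by (metis order_trans)+
    have un: "E = E1 \<union> E2" using ab unfolding E1_def E2_def by auto
    have keep1: "e \<in> E1" and keep2: "e \<in> E2" if "e \<in> E" "fst e \<noteq> x" for e
      using that unfolding E1_def E2_def by auto
    have c1: "card E1 < card E" using ab finE unfolding E1_def by (intro psubset_card_mono) auto
    have "(x, b) \<in> E - E2" using ab by (simp add: E2_def)
    then have c2: "card E2 < card E" using sub finE by (intro psubset_card_mono) auto
    \<comment> \<open>Since \<open>x\<close> belongs to the opponent, both subgraphs keep all edges
      of \<open>U\<close>, so a refutation in either is one in \<open>E\<close>.\<close>
    have lift: "refutes V U E G w" if r: "refutes V U E' G w" and E': "E' = E1 \<or> E' = E2" for E' w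
    proof -
      from r obtain F where F: "F \<subseteq> E'" "total_graph V F" "\<And>e. e \<in> E' \<Longrightarrow> fst e \<in> U \<Longrightarrow> e \<in> F"
        "\<And>\<pi>. \<pi> \<in> runs F \<Longrightarrow> \<pi> 0 = w \<Longrightarrow> \<not> all_mean_ge0 G \<pi>"
        unfolding refutes_def by blast
      moreover have "F \<subseteq> E" using F(1) E' un by blast
      moreover have "e \<in> F" if "e \<in> E" "fst e \<in> U" for e
      proof -
        have "fst e \<noteq> x" using that(2) x(2) by blast
        then have "e \<in> E'" using E' keep1[OF that(1)] keep2[OF that(1)] by blast
        then show ?thesis using F(3) that(2) by blast
      qed
      ultimately show ?thesis unfolding refutes_def by blast
    qed
    show ?thesis
    proof (cases "refutes V U E2 G x")
      case True
      have "forces U E2 G u \<Longrightarrow> forces U E G u"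
        by (rule forces_of_losing_vertex[OF tot less.prems(3) sub(2) _ True]) (rule keep2)
      then show ?thesis
        using less.hyps[OF c2 tot2 UV less.prems(3)] lift[of E2 u] by blast
    next
      case False
      then have "forces U E2 G x" using less.hyps[OF c2 tot2 UV x(1)] by blast
      then have "forces U E1 G u \<Longrightarrow> forces U E G u"
        using keep1 keep2
        by (intro forces_shuffle[OF tot UV x less.prems(3) tot1 tot2 un]) auto
      then show ?thesis
        using less.hyps[OF c1 tot1 UV less.prems(3)] lift[of E1 u] by blast
    qed
  next
    case False
    then have det: "y = y'" if "z \<in> V - U" "(z, y) \<in> E" "(z, y') \<in> E" for z y y'
      using that by blast
    show ?thesis
    proof (cases "\<exists>\<pi>\<in>runs E. \<pi> 0 = u \<and> all_mean_ge0 G \<pi>")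
      case True
      then obtain \<pi> where \<pi>: "\<pi> \<in> runs E" "\<pi> 0 = u" "all_mean_ge0 G \<pi>" by blast
      \<comment> \<open>The opponent has no choice left, so \<open>U\<close> can make any run happen
        by copying it, indexed by the length of the history.\<close>
      define \<sigma> where "\<sigma> = (\<lambda>h. if (last h, \<pi> (length h)) \<in> E then \<pi> (length h)
        else SOME y. (last h, y) \<in> E)"
      have leg: "legal U E \<sigma>"
        unfolding \<sigma>_def using tot UV by (rule legal_fallback)
      have "\<rho> = \<pi>" if \<rho>: "\<rho> \<in> runs E" "\<rho> 0 = u" "consistent U \<sigma> \<rho>" for \<rho>
      proof
        fix k show "\<rho> k = \<pi> k"
        proof (induction k)
          case (Suc k)
          have ed: "(\<rho> k, \<rho> (Suc k)) \<in> E" "(\<rho> k, \<pi> (Suc k)) \<in> E"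
            using runsD[OF \<rho>(1), of k] runsD[OF \<pi>(1), of k] Suc by simp_all
          show ?case
          proof (cases "\<rho> k \<in> U")
            case True
            then have "\<rho> (Suc k) = \<sigma> (prefix_upto \<rho> k)" using \<rho> by (simp add: consistent_def)
            then show ?thesis using ed by (simp add: \<sigma>_def last_prefix_upto)
          next
            case False
            then show ?thesis using det ed tot unfolding total_graph_def by blast
          qed
        qed (use \<rho> \<pi> in simp)
      qed
      then have "forces U E G u" unfolding forces_def using leg \<pi> by blast
      then show ?thesis ..
    next
      case False
      then show ?thesis using tot unfolding refutes_def by blast
    qed
  qed
qed

section \<open>Compactness of mean objectives\<close>

text \<open>\<open>m\<close> climbs only once the square of the next length is at most
  \<open>j\<close>. So \<open>m\<close> tends to infinity, while the length \<open>L (m j)\<close>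
  used at step \<open>j\<close> grows at most like the square root of \<open>j\<close>.\<close>

lemma ex_slow_sequence:
  fixes L :: "nat \<Rightarrow> nat"
  shows "\<exists>m. (\<forall>n. \<exists>J. \<forall>j\<ge>J. n \<le> m j) \<and> (\<exists>K. \<forall>j. (L (m j))\<^sup>2 \<le> j + K)"
proof -
  define m where "m = rec_nat 0 (\<lambda>j i. if (L (Suc i))\<^sup>2 \<le> j then Suc i else i)"
  have m0: "m 0 = 0" and mS: "m (Suc j) = (if (L (Suc (m j)))\<^sup>2 \<le> j then Suc (m j) else m j)" for j
    by (simp_all add: m_def)
  have "mono m" by (rule incseq_SucI) (simp add: mS)
  have "(L (m j))\<^sup>2 \<le> j + (L 0)\<^sup>2" for j
    by (induction j) (auto simp: m0 mS)
  moreover have "\<exists>J. \<forall>j\<ge>J. n \<le> m j" for n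
  proof (induction n)
    case (Suc n)
    then obtain J where J: "\<forall>j\<ge>J. n \<le> m j" by blast
    define J' where "J' = max J ((L (Suc n))\<^sup>2)"
    have "Suc n \<le> m (Suc J')"
    proof (cases "m J' = n")
      case True
      then show ?thesis by (simp add: mS J'_def)
    next
      case False
      then show ?thesis using J[rule_format, of J'] by (simp add: mS J'_def)
    qed
    then show ?case using monoD[OF \<open>mono m\<close>] by (meson order_trans)
  qed simp
  ultimately show ?thesis by blast
qed

lemma cpath_prefix_upto:
  assumes "\<pi> \<in> runs E"
  shows "cpath {} E \<sigma> (\<pi> 0) (prefix_upto \<pi> k)"
  using assms by (auto simp: cpath_def runs_def)

lemma cpath_append:
  assumes h: "cpath {} E \<sigma> u h" and w: "cpath {} E \<sigma> (last h) w"
  shows "cpath {} E \<sigma> u (h @ tl w)" "last (h @ tl w) = last w"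
    "wsum f (h @ tl w) = wsum f h + wsum f w"
proof -
  have "cpath {} E \<sigma> u (h @ tl w) \<and> last (h @ tl w) = last w \<and>
      wsum f (h @ tl w) = wsum f h + wsum f w"
    using w
  proof (induction w rule: rev_induct)
    case Nil
    then show ?case by (simp add: cpath_def)
  next
    case (snoc y w)
    show ?case
    proof (cases "w = []")
      case True
      then show ?thesis using snoc.prems h by (simp add: cpath_def)
    next
      case False
      have "cpath {} E \<sigma> (last h) w" unfolding cpath_def
      proof (intro conjI allI impI)
        fix i assume i: "Suc i < length w"
        then show "(w ! i, w ! Suc i) \<in> E"
          using snoc.prems unfolding cpath_def by (auto simp: nth_append dest!: spec[of _ i])
      qed (use snoc.prems False in \<open>auto simp: cpath_def\<close>)
      then have IH: "cpath {} E \<sigma> u (h @ tl w)" "last (h @ tl w) = last w"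
        "wsum f (h @ tl w) = wsum f h + wsum f w"
        using snoc.IH by auto
      have ed: "(last w, y) \<in> E"
      proof -
        have "Suc (length w - 1) < length (w @ [y])" using False by simp
        then have "((w @ [y]) ! (length w - 1), (w @ [y]) ! Suc (length w - 1)) \<in> E"
          using snoc.prems unfolding cpath_def by blast
        then show ?thesis using False by (simp add: nth_append last_conv_nth)
      qed
      have t: "h @ tl (w @ [y]) = (h @ tl w) @ [y]" using False by simp
      have "h \<noteq> []" using h by (simp add: cpath_def)
      then show ?thesis unfolding t
        using cpath_snoc[OF IH(1), of y] IH ed False by (simp add: wsum_snoc del: append_assoc)
    qed
  qed
  then show "cpath {} E \<sigma> u (h @ tl w)" "last (h @ tl w) = last w"
    "wsum f (h @ tl w) = wsum f h + wsum f w" by auto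
qed

lemma runs_in_V: "total_graph V E \<Longrightarrow> \<pi> \<in> runs E \<Longrightarrow> \<pi> k \<in> V"
  using runsD[of \<pi> E k] unfolding total_graph_def by blast

lemma runs_shift: "\<pi> \<in> runs E \<Longrightarrow> (\<lambda>j. \<pi> (n + j)) \<in> runs E"
  by (simp add: runs_def)

text \<open>Only infinitely many good times are required of the approximating runs, and they may
  be different runs for different \<open>d\<close>; between two good times at the same vertex there is
  a closed walk of mean almost nonnegative, and such walks are concatenated.\<close>
lemma ex_obj_run_of_approximations:
  fixes G :: "('v \<times> 'v \<Rightarrow> real) set"
  assumes tot: "total_graph V F" and u: "u \<in> V"
    and B: "\<And>f e. f \<in> G \<Longrightarrow> e \<in> F \<Longrightarrow> \<bar>f e\<bar> \<le> B"
    and approx: "\<And>d. d > 0 \<Longrightarrow>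
      \<exists>\<rho>\<in>runs F. \<rho> 0 = u \<and> infinite {k. \<forall>f\<in>G. - d * real k \<le> psum f \<rho> k}"
  shows "\<exists>\<rho>\<in>runs F. \<rho> 0 = u \<and> all_mean_ge0 G \<rho>"
proof -
  define \<sigma> :: "'v list \<Rightarrow> 'v" where "\<sigma> = (\<lambda>_. u)"
  have finV: "finite V" using tot by (simp add: total_graph_def)
  \<comment> \<open>Length at least 2 means at least one edge, so that concatenating such walks
    produces arbitrarily long ones.\<close>
  define good where "good = (\<lambda>d z w. cpath {} F \<sigma> z w \<and> last w = z \<and> 2 \<le> length w \<and>
     (\<forall>f\<in>G. - d * real (length w - 1) \<le> wsum f w))"
  have goodI: "\<exists>z p w. z \<in> V \<and> cpath {} F \<sigma> u p \<and> last p = z \<and> good d z w" if "d > 0" for d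
  proof -
    obtain \<rho> where \<rho>: "\<rho> \<in> runs F" "\<rho> 0 = u"
      and "infinite {k. \<forall>f\<in>G. - (d/2) * real k \<le> psum f \<rho> k}" (is "infinite ?K")
      using approx[of "d/2"] \<open>d > 0\<close> by auto
    moreover have "finite (\<rho> ` ?K)"
      using runs_in_V[OF tot \<rho>(1)] by (intro finite_subset[OF _ finV]) auto
    ultimately obtain k0 where "infinite {k \<in> ?K. \<rho> k = \<rho> k0}"
      using pigeonhole_infinite[of ?K \<rho>] by blast
    then have inf: "infinite {k \<in> ?K. \<rho> k = z}" if "z = \<rho> k0" for z using that by simp
    define z where "z = \<rho> k0"
    obtain k1 where k1: "\<rho> k1 = z" using z_def by simp
    \<comment> \<open>The run is good up to \<open>d/2\<close>. Beyond \<open>r\<close>, the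
      remaining \<open>d/2 * k2\<close> outweighs \<open>(B + d) * k1\<close>, the cost of cutting
      off the first \<open>k1\<close> edges.\<close>
    obtain r :: nat where r: "2 * (B + d) * real k1 / d \<le> real r" using real_arch_simple by blast
    obtain k2 where k2: "k2 > max k1 r" "k2 \<in> ?K" "\<rho> k2 = z"
      using inf[OF z_def] unfolding infinite_nat_iff_unbounded by blast
    define w where "w = prefix_upto (\<lambda>j. \<rho> (k1 + j)) (k2 - k1)"
    have "cpath {} F \<sigma> z w" unfolding w_def
      using cpath_prefix_upto[OF runs_shift[OF \<rho>(1)], of \<sigma> k1] k1 by simp
    moreover have "last w = z" using k2 by (simp add: w_def last_prefix_upto)
    moreover have "2 \<le> length w" using k2(1) by (simp add: w_def) arith
    moreover have "- d * real (length w - 1) \<le> wsum f w" if "f \<in> G" for f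
    proof -
      have "wsum f w = psum f \<rho> k2 - psum f \<rho> k1"
        using psum_shift[of f \<rho> k1 "k2 - k1"] k2 by (simp add: w_def)
      moreover have "- (d/2) * real k2 \<le> psum f \<rho> k2" using k2 that by blast
      moreover have "psum f \<rho> k1 \<le> B * real k1"
        using psum_bound[OF \<rho>(1), of f B k1] B[OF that] by (auto simp: abs_le_iff)
      moreover have "2 * (B + d) * real k1 \<le> d * real k2"
      proof -
        have "2 * (B + d) * real k1 \<le> d * real r" using r \<open>d > 0\<close> by (simp add: field_simps)
        also have "\<dots> \<le> d * real k2" using k2 \<open>d > 0\<close> by simp
        finally show ?thesis .
      qed
      moreover have "d * real (length w - 1) = d * real k2 - d * real k1"
        using k2(1) by (simp add: w_def of_nat_diff right_diff_distrib)
      ultimately show ?thesis by (simp add: algebra_simps)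
    qed
    ultimately have "good d z w" unfolding good_def by blast
    moreover have "cpath {} F \<sigma> u (prefix_upto \<rho> k1)" "last (prefix_upto \<rho> k1) = z"
      using cpath_prefix_upto[OF \<rho>(1), of \<sigma> k1] \<rho>(2) k1 by (simp_all add: last_prefix_upto)
    moreover have "z \<in> V" unfolding z_def by (rule runs_in_V[OF tot \<rho>(1)])
    ultimately show ?thesis by blast
  qed
  have "\<forall>n. \<exists>z p w. z \<in> V \<and> cpath {} F \<sigma> u p \<and> last p = z \<and> good (1 / real (Suc n)) z w"
    using goodI by simp
  then obtain zz pp ww where zpw: "\<And>n. zz n \<in> V" "\<And>n. cpath {} F \<sigma> u (pp n)"
    "\<And>n. last (pp n) = zz n" "\<And>n. good (1 / real (Suc n)) (zz n) (ww n)"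
    by metis
  \<comment> \<open>A second pigeonhole, now over the tolerances: infinitely many of the closed
    walks sit at one vertex \<open>z\<close> and can be concatenated. A walk for a smaller tolerance
    also serves a larger one.\<close>
  have "finite (range zz)" using zpw(1) by (intro finite_subset[OF _ finV]) auto
  then obtain n0 where inf: "infinite {n. zz n = zz n0}"
    using pigeonhole_infinite[of UNIV zz] by auto
  define z where "z = zz n0"
  define p where "p = pp n0"
  have p: "cpath {} F \<sigma> u p" "last p = z" using zpw by (simp_all add: p_def z_def)
  have "\<exists>w. good (1 / real (Suc n)) z w" for n
  proof -
    obtain n' where n': "n' > n" "zz n' = z"
      using inf unfolding infinite_nat_iff_unbounded z_def by blast
    have "1 / real (Suc n') * real l \<le> 1 / real (Suc n) * real l" for l
      using n' by (intro mult_right_mono divide_left_mono) auto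
    then have "good (1 / real (Suc n)) z (ww n')"
      using zpw(4)[of n'] n' unfolding good_def by (smt (verit) mult_minus_left)
    then show ?thesis by blast
  qed
  then obtain w where w: "\<And>n. good (1 / real (Suc n)) z (w n)" by metis
  define L where "L = (\<lambda>n. length (w n) - 1)"
  obtain m K where slow: "\<And>n. \<exists>J. \<forall>j\<ge>J. n \<le> m j" and sq: "\<And>j. (L (m j))\<^sup>2 \<le> j + K"
    using ex_slow_sequence[of L] by blast
  \<comment> \<open>A prefix leading to \<open>z\<close>, then at step \<open>j\<close> the closed
    walk \<open>w (m j)\<close>: tolerances tend to zero, while lengths stay small against
    \<open>j\<close>.\<close>
  define s where "s = rec_nat p (\<lambda>j h. h @ tl (w (m j)))"
  have s0: "s 0 = p" and sS: "s (Suc j) = s j @ tl (w (m j))" for j by (simp_all add: s_def)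
  have s: "cpath {} F \<sigma> u (s j) \<and> last (s j) = z" for j
  proof (induction j)
    case (Suc j)
    then show ?case using cpath_append[of F \<sigma> u "s j" "w (m j)"] w[of "m j"]
      by (simp add: sS good_def)
  qed (simp add: s0 p)
  have sW: "wsum f (s (Suc j)) = wsum f (s j) + wsum f (w (m j))" for f j
    using cpath_append(3)[of F \<sigma> u "s j" "w (m j)"] s[of j] w[of "m j"] by (simp add: sS good_def)
  define N where "N = (\<lambda>j. length (s j) - 1)"
  have Lpos: "L (m j) \<ge> 1" for j using w[of "m j"] unfolding good_def L_def by linarith
  have NS: "N (Suc j) = N j + L (m j)" for j
  proof -
    have "s j \<noteq> []" using s[of j] by (simp add: cpath_def)
    then show ?thesis by (cases "s j") (simp_all add: N_def sS L_def)
  qed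
  have Nj: "j \<le> N j" for j
  proof (induction j)
    case (Suc j) then show ?case using Lpos[of j] by (simp add: NS)
  qed simp
  have "mono N" by (rule incseq_SucI) (simp add: NS)
  have "legal {} F \<sigma>" by (simp add: legal_def)
  then obtain \<rho> where \<rho>: "\<rho> \<in> runs F" "\<rho> 0 = u" "\<And>j. prefix_upto \<rho> (N j) = s j"
    using ex_limit_chain[OF tot u, of "{}" \<sigma> s] s unfolding N_def sS by auto
  have ps: "psum f \<rho> (N j) = wsum f (s j)" for f j
    using \<rho>(3)[of j] wsum_prefix_upto by metis
  have "all_mean_ge0 G \<rho>" unfolding all_mean_ge0_def mean_ge0_def
  proof (intro ballI allI impI)
    fix f and e :: real assume f: "f \<in> G" and e: "e > 0"
    have lip: "psum f \<rho> n - B * real i \<le> psum f \<rho> (n + i)" for n i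
      using psum_bound[OF runs_shift[OF \<rho>(1)], of f B n i] B[OF f] by (simp add: psum_shift abs_le_iff)
    have B0: "B \<ge> 0" using B[OF f runsD[OF \<rho>(1)]] abs_ge_zero order_trans by blast
    obtain n where n: "2 / e \<le> real n" using real_arch_simple by blast
    obtain J where J: "\<forall>j\<ge>J. n \<le> m j" using slow by blast
    define C1 where "C1 = B * real (N J)"
    \<comment> \<open>Bound at the ends of the walks: from \<open>J\<close> on each walk has mean at
      least \<open>-e/2\<close>, and all that comes before costs at most \<open>C1\<close>.\<close>
    have A: "- C1 - e/2 * real (N j) \<le> psum f \<rho> (N j)" for j
    proof (cases "j \<le> J")
      case True
      then have "N j \<le> N J" using monoD[OF \<open>mono N\<close>] by blast
      then have "B * real (N j) \<le> C1" using B0 by (simp add: C1_def mult_left_mono)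
      moreover have "0 \<le> e / 2 * real (N j)" using e by simp
      ultimately show ?thesis using lip[of 0 "N j"] by simp
    next
      case False
      then have "J \<le> j" by simp
      then show ?thesis
      proof (induction j rule: dec_induct)
        case base
        have "0 \<le> e / 2 * real (N J)" using e by simp
        then show ?case using lip[of 0 "N J"] by (simp add: C1_def)
      next
        case (step j)
        have "1 / real (Suc (m j)) \<le> e / 2"
        proof -
          have "2 / e \<le> real (Suc (m j))" using n J step by (metis le_SucI of_nat_le_iff order_trans)
          then show ?thesis using e by (simp add: field_simps)
        qed
        then have "1 / real (Suc (m j)) * real (L (m j)) \<le> e / 2 * real (L (m j))"
          by (rule mult_right_mono) simp
        moreover have "- (1 / real (Suc (m j))) * real (L (m j)) \<le> wsum f (w (m j))"
          using w[of "m j"] f unfolding good_def L_def by blast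
        ultimately have "- (e / 2 * real (L (m j))) \<le> wsum f (w (m j))" by linarith
        moreover have "psum f \<rho> (N (Suc j)) = psum f \<rho> (N j) + wsum f (w (m j))"
          by (simp only: ps sW)
        moreover have "e / 2 * real (N (Suc j)) = e / 2 * real (N j) + e / 2 * real (L (m j))"
          by (simp add: NS distrib_left)
        ultimately show ?case using step.IH by linarith
      qed
    qed
    \<comment> \<open>Expanding \<open>0 \<le> (e * L - B)\<^sup>2\<close> bounds
      \<open>B * L\<close> by \<open>e/2 * L\<^sup>2 + B\<^sup>2 / (2 * e)\<close>, and
      \<open>sq\<close> bounds the square by \<open>j + K\<close>. So a partly traversed walk costs
      at most \<open>e/2 * j\<close> plus a constant.\<close>
    define C2 where "C2 = B\<^sup>2 / (2 * e) + e / 2 * real K"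
    have BL: "B * real (L (m j)) \<le> e / 2 * real j + C2" for j
    proof -
      have "0 \<le> (e * real (L (m j)) - B)\<^sup>2 / (2 * e)" using e by simp
      also have "\<dots> = e / 2 * (real (L (m j)))\<^sup>2 - B * real (L (m j)) + B\<^sup>2 / (2 * e)"
        using e by (simp add: power2_eq_square field_simps)
      finally have "B * real (L (m j)) \<le> e / 2 * (real (L (m j)))\<^sup>2 + B\<^sup>2 / (2 * e)" by simp
      also have "e / 2 * (real (L (m j)))\<^sup>2 \<le> e / 2 * (real j + real K)"
        using sq[of j] e by (intro mult_left_mono) (simp_all flip: of_nat_power of_nat_add)
      finally show ?thesis by (simp add: C2_def distrib_left)
    qed
    have C20: "C2 \<ge> 0" using e by (simp add: C2_def)
    have C10: "C1 \<ge> 0" using B0 by (simp add: C1_def)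
    define C where "C = C1 + C2 + B * real (N 0)"
    have "- C - e * real k \<le> psum f \<rho> k" for k
    proof (cases "k < N 0")
      case True
      then have "B * real k \<le> B * real (N 0)" using B0 by (intro mult_left_mono) auto
      moreover have "0 \<le> e * real k" using e by simp
      ultimately show ?thesis using lip[of 0 k] C10 C20 unfolding C_def by simp
    next
      case False
      \<comment> \<open>Time \<open>k\<close> falls within the walk from \<open>N j\<close> to
        \<open>N (Suc j)\<close>: half of \<open>e\<close> pays for the completed walks, half for
        the partial one.\<close>
      define i where "i = (LEAST j. k < N j)"
      have ex: "k < N (Suc k)" using Nj[of "Suc k"] by simp
      then have i: "k < N i" unfolding i_def by (rule LeastI)
      then obtain j where j: "i = Suc j" using False by (cases i) auto
      have "\<not> k < N j" using not_less_Least[of j "\<lambda>j. k < N j"] j unfolding i_def by simp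
      then obtain r where r: "k = N j + r" using le_Suc_ex not_less by blast
      have "B * real r \<le> B * real (L (m j))" using i r B0 by (intro mult_left_mono) (simp_all add: j NS)
      moreover have "e / 2 * real j \<le> e / 2 * real k" "e / 2 * real (N j) \<le> e / 2 * real k"
        using e Nj[of j] r by simp_all
      moreover have "0 \<le> B * real (N 0)" using B0 by simp
      ultimately show ?thesis using lip[of "N j" r] A[of j] BL[of j] unfolding C_def r by linarith
    qed
    then show "\<exists>C. \<forall>k. - C - e * real k \<le> psum f \<rho> k" by blast
  qed
  then show ?thesis using \<rho> by blast
qed

section \<open>Mean-payoff games\<close>

definition real_wt :: "'v arena_data \<Rightarrow> player \<Rightarrow> 'v \<times> 'v \<Rightarrow> real" where
  "real_wt A i e = real_of_int (wt A i e)"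

lemma hist_weight_prefix_upto: "real_of_int (hist_weight A i (prefix_upto \<pi> k)) = psum (real_wt A i) \<pi> k"
  by (simp add: hist_weight_def psum_def real_wt_def)

lemma psum_minus_const: "psum (\<lambda>e. f e - d) \<pi> k = psum f \<pi> k - d * real k"
  by (induction k) (simp_all add: psum_Suc algebra_simps)

lemma psum_const_minus: "psum (\<lambda>e. d - f e) \<pi> k = d * real k - psum f \<pi> k"
  by (induction k) (simp_all add: psum_Suc algebra_simps)

lemma MP_psum: "MP A i \<pi> = liminf (\<lambda>k. ereal (1 / real k * psum (real_wt A i) \<pi> k))"
  by (simp add: MP_def hist_weight_prefix_upto)

text \<open>Divided by \<open>k\<close>, the constant \<open>C\<close> vanishes; conversely it
  absorbs the finitely many times at which the mean is still too low.\<close>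

lemma le_MP_iff: "ereal d \<le> MP A i \<pi> \<longleftrightarrow> mean_ge0 (\<lambda>e. real_wt A i e - d) \<pi>"
proof
  assume L: "ereal d \<le> MP A i \<pi>"
  show "mean_ge0 (\<lambda>e. real_wt A i e - d) \<pi>" unfolding mean_ge0_def
  proof (intro allI impI)
    fix e :: real assume e: "e > 0"
    have "\<forall>\<^sub>F k in sequentially. ereal (d - e) < ereal (1 / real k * psum (real_wt A i) \<pi> k)"
      using L e unfolding MP_psum le_Liminf_iff by (auto dest!: spec[of _ "ereal (d - e)"])
    then obtain N where N: "\<And>k. k \<ge> N \<Longrightarrow> d - e < 1 / real k * psum (real_wt A i) \<pi> k"
      unfolding eventually_sequentially by auto
    define C where "C = (\<Sum>j\<le>N. \<bar>psum (\<lambda>e. real_wt A i e - d) \<pi> j\<bar>)"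
    have "- C - e * real k \<le> psum (\<lambda>e. real_wt A i e - d) \<pi> k" for k
    proof (cases "k \<le> N")
      case True
      then have "\<bar>psum (\<lambda>e. real_wt A i e - d) \<pi> k\<bar> \<le> C"
        unfolding C_def by (intro member_le_sum) auto
      moreover have "0 \<le> e * real k" using e by simp
      ultimately show ?thesis by linarith
    next
      case False
      then have k: "real k > 0" by simp
      then have "(d - e) * real k < psum (real_wt A i) \<pi> k"
        using N[of k] False by (simp add: field_simps)
      moreover have "C \<ge> 0" unfolding C_def by (intro sum_nonneg) auto
      ultimately show ?thesis by (simp add: psum_minus_const algebra_simps)
    qed
    then show "\<exists>C. \<forall>k. - C - e * real k \<le> psum (\<lambda>e. real_wt A i e - d) \<pi> k" by blast
  qed
next
  assume R: "mean_ge0 (\<lambda>e. real_wt A i e - d) \<pi>"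
  show "ereal d \<le> MP A i \<pi>" unfolding MP_psum le_Liminf_iff
  proof (intro allI impI)
    fix y assume "y < ereal d"
    then obtain z where z: "y < ereal z" "z < d" using ereal_dense2 by (metis ereal_less_eq(3) less_ereal.simps(1))
    \<comment> \<open>Half of the gap is the error in the slope, the other half covers
      \<open>C / k\<close> for large \<open>k\<close>.\<close>
    define e where "e = (d - z) / 2"
    have e: "e > 0" using z by (simp add: e_def)
    then obtain C where C: "\<And>k. - C - e * real k \<le> psum (\<lambda>e. real_wt A i e - d) \<pi> k"
      using R unfolding mean_ge0_def by blast
    obtain N :: nat where N: "C / e < real N" using reals_Archimedean2 by blast
    have "z < 1 / real k * psum (real_wt A i) \<pi> k" if "k \<ge> Suc N" for k
    proof -
      have k: "real k > 0" "C / e < real k" using that N by (auto intro: less_le_trans)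
      then have "C < e * real k" using e by (simp add: field_simps)
      moreover have "z * real k = d * real k - 2 * (e * real k)" by (simp add: e_def field_simps)
      ultimately have "z * real k < psum (real_wt A i) \<pi> k" using C[of k] by (simp add: psum_minus_const)
      then show ?thesis using k by (simp add: field_simps)
    qed
    then have "y < ereal (1 / real k * psum (real_wt A i) \<pi> k)" if "k \<ge> Suc N" for k
      using z(1) that by (metis less_trans less_ereal.simps(1))
    then show "\<forall>\<^sub>F k in sequentially. y < ereal (1 / real k * psum (real_wt A i) \<pi> k)"
      unfolding eventually_sequentially by blast
  qed
qed

lemma ereal_eqI_real_le:
  fixes x y :: ereal
  assumes "\<And>d. ereal d \<le> x \<longleftrightarrow> ereal d \<le> y"
  shows "x = y"
proof (rule ccontr)
  assume "x \<noteq> y"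
  then consider "x < y" | "y < x" by fastforce
  then show False using assms ereal_dense2 by cases (meson less_le_not_le order_less_imp_le leD)+
qed

lemma MP_shift: "MP A i (\<lambda>j. \<pi> (n + j)) = MP A i \<pi>"
  by (rule ereal_eqI_real_le) (simp only: le_MP_iff mean_ge0_shift)

text \<open>The hypothesis bounds the lim sup of the means and is in general stronger than the
  conclusion about the lim inf.\<close>

lemma MP_leI:
  assumes "mean_ge0 (\<lambda>e. c - real_wt A i e) \<pi>"
  shows "MP A i \<pi> \<le> ereal c"
proof (rule ccontr)
  assume "\<not> MP A i \<pi> \<le> ereal c"
  then obtain z where z: "c < z" "ereal z \<le> MP A i \<pi>"
    using ereal_dense2[of "ereal c" "MP A i \<pi>"] by (auto simp: not_le intro: less_imp_le)
  \<comment> \<open>Two quarters of the gap go to the slopes of the two bounds, two to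
    \<open>C1 + C2\<close>.\<close>
  define e where "e = (z - c) / 4"
  have e: "e > 0" using z by (simp add: e_def)
  obtain C1 C2 where C: "\<And>k. - C1 - e * real k \<le> psum (\<lambda>e. c - real_wt A i e) \<pi> k"
    "\<And>k. - C2 - e * real k \<le> psum (\<lambda>e. real_wt A i e - z) \<pi> k"
    using assms z(2) e unfolding le_MP_iff mean_ge0_def by blast
  obtain k :: nat where k: "(C1 + C2) / (2 * e) < real k" using reals_Archimedean2 by blast
  have "c * real k = z * real k - 4 * (e * real k)" by (simp add: e_def field_simps)
  moreover have "C1 + C2 < 2 * (e * real k)" using k e by (simp add: field_simps)
  ultimately show False
    using C[of k] unfolding psum_minus_const psum_const_minus by linarith
qed

text \<open>If these times were finite in number, the mean would exceed \<open>c + d\<close> at all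
  later ones, and so the lim inf would be at least \<open>c + d\<close>.\<close>

lemma infinite_MP_le:
  assumes "MP A i \<pi> \<le> ereal c" "d > 0"
  shows "infinite {k. - d * real k \<le> psum (\<lambda>e. c - real_wt A i e) \<pi> k}" (is "infinite ?K")
proof
  assume "finite ?K"
  then obtain N where N: "\<forall>k\<in>?K. k \<le> N" unfolding finite_nat_set_iff_bounded_le ..
  define f where "f = (\<lambda>e. real_wt A i e - (c + d))"
  define C where "C = (\<Sum>j\<le>N. \<bar>psum f \<pi> j\<bar>)"
  have "- C \<le> psum f \<pi> k" for k
  proof (cases "k \<le> N")
    case True
    then have "\<bar>psum f \<pi> k\<bar> \<le> C" unfolding C_def by (intro member_le_sum) auto
    then show ?thesis by linarith
  next
    case False
    then have "k \<notin> ?K" using N by (meson not_less)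
    then have "0 \<le> psum f \<pi> k" by (simp add: f_def psum_minus_const psum_const_minus algebra_simps)
    moreover have "C \<ge> 0" unfolding C_def by (intro sum_nonneg) auto
    ultimately show ?thesis by linarith
  qed
  then have "- C - e * real k \<le> psum f \<pi> k" if "e > 0" for e k
    using that by (smt (verit) mult_nonneg_nonneg of_nat_0_le_iff)
  then have "mean_ge0 f \<pi>" unfolding mean_ge0_def by blast
  then have "ereal (c + d) \<le> MP A i \<pi>" unfolding f_def le_MP_iff .
  then have "ereal (c + d) \<le> ereal c" using assms(1) by (rule order_trans)
  then show False using assms(2) by simp
qed

section \<open>Strategies and outcomes in an arena\<close>

context arena
begin

lemma finite_edges: "finite (edges A)"
  using finite_subset[OF edges_subset] finite_verts by simp

lemma plays_runs: "plays A = runs (edges A)"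
  by (simp add: plays_def runs_def)

lemma total_graph_edges: "total_graph (verts A) (edges A)"
  using finite_verts edges_subset edge_out by (simp add: total_graph_def)

lemma own_subset: "own A i \<subseteq> verts A"
  using own_Un by (cases i) auto

lemma play_in_verts: "\<pi> \<in> plays A \<Longrightarrow> \<pi> k \<in> verts A"
  unfolding plays_runs using runs_in_V[OF total_graph_edges] by blast

lemma prefix_in_histories: "\<pi> \<in> plays A \<Longrightarrow> prefix_upto \<pi> k \<in> histories A"
  by (auto simp: histories_def)

lemma last_history_in_verts: "h \<in> histories A \<Longrightarrow> last h \<in> verts A"
  using play_in_verts by (auto simp: histories_def last_prefix_upto)

lemma weight_bound: "\<exists>B. \<forall>i. \<forall>e\<in>edges A. \<bar>real_wt A i e\<bar> \<le> B"
proof -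
  define B where "B = (\<Sum>e\<in>edges A. \<bar>real_wt A P0 e\<bar> + \<bar>real_wt A P1 e\<bar>)"
  have "\<bar>real_wt A i e\<bar> \<le> B" if "e \<in> edges A" for i e
  proof -
    have "\<bar>real_wt A P0 e\<bar> + \<bar>real_wt A P1 e\<bar> \<le> B" unfolding B_def
      using that finite_edges by (intro member_le_sum) auto
    then show ?thesis by (cases i) auto
  qed
  then show ?thesis by blast
qed

lemma MP_bounded: "\<exists>B. \<forall>\<pi>\<in>plays A. \<forall>i. ereal (- B) \<le> MP A i \<pi> \<and> MP A i \<pi> \<le> ereal B"
proof -
  obtain B where B: "\<And>i e. e \<in> edges A \<Longrightarrow> \<bar>real_wt A i e\<bar> \<le> B" using weight_bound by blast
  have "ereal (- B) \<le> MP A i \<pi> \<and> MP A i \<pi> \<le> ereal B" if "\<pi> \<in> plays A" for \<pi> i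
  proof -
    have b: "\<bar>psum (real_wt A i) \<pi> k\<bar> \<le> B * real k" for k
      using psum_bound[of \<pi> "edges A" "real_wt A i" B] that B by (simp add: plays_runs)
    have "0 \<le> psum (\<lambda>e. real_wt A i e - - B) \<pi> k" "0 \<le> psum (\<lambda>e. B - real_wt A i e) \<pi> k" for k
      using b[of k] unfolding psum_minus_const psum_const_minus by (simp_all add: abs_le_iff)
    then have "mean_ge0 (\<lambda>e. real_wt A i e - - B) \<pi>" "mean_ge0 (\<lambda>e. B - real_wt A i e) \<pi>"
      unfolding mean_ge0_def by (smt (verit) mult_nonneg_nonneg of_nat_0_le_iff)+
    then show ?thesis using MP_leI[of B A i \<pi>] le_MP_iff[of "- B" A i \<pi>] by blast
  qed
  then show ?thesis by blast
qed

lemma MP_real: "\<pi> \<in> plays A \<Longrightarrow> \<exists>r. MP A i \<pi> = ereal r"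
proof -
  assume "\<pi> \<in> plays A"
  then obtain B where "ereal (- B) \<le> MP A i \<pi>" "MP A i \<pi> \<le> ereal B" using MP_bounded by blast
  then show ?thesis by (cases "MP A i \<pi>") auto
qed

lemma Out_props:
  assumes "u \<in> verts A" "\<sigma>0 \<in> strategies A P0" "\<sigma>1 \<in> strategies A P1"
  shows "Out A u \<sigma>0 \<sigma>1 \<in> plays A" "Out A u \<sigma>0 \<sigma>1 0 = u"
    "follows A P0 \<sigma>0 (Out A u \<sigma>0 \<sigma>1)" "follows A P1 \<sigma>1 (Out A u \<sigma>0 \<sigma>1)"
  using theI'[OF ex1_outcome[OF assms]] unfolding Out_def by auto

lemma Out_eqI:
  assumes "u \<in> verts A" "\<sigma>0 \<in> strategies A P0" "\<sigma>1 \<in> strategies A P1"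
    and "\<pi> \<in> plays A" "\<pi> 0 = u" "follows A P0 \<sigma>0 \<pi>" "follows A P1 \<sigma>1 \<pi>"
  shows "Out A u \<sigma>0 \<sigma>1 = \<pi>"
  unfolding Out_def using assms by (intro the1_equality ex1_outcome) auto

definition move_dom :: "player \<Rightarrow> 'v list set" where
  "move_dom i = {h \<in> histories A. last h \<in> own A i}"

lemma strategies_dom: "strategies A i = (\<Pi>\<^sub>E h \<in> move_dom i. {u'. (last h, u') \<in> edges A})"
  by (simp add: strategies_def move_dom_def)

lemma restrict_in_strategies:
  assumes "\<And>h. h \<in> move_dom i \<Longrightarrow> (last h, \<sigma> h) \<in> edges A"
  shows "restrict \<sigma> (move_dom i) \<in> strategies A i"
  using assms by (auto simp: strategies_dom)

lemma prefix_in_move_dom: "\<pi> \<in> plays A \<Longrightarrow> \<pi> k \<in> own A i \<Longrightarrow> prefix_upto \<pi> k \<in> move_dom i"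
  by (simp add: move_dom_def prefix_in_histories last_prefix_upto)

lemma follows_restrict:
  assumes "\<pi> \<in> plays A"
  shows "follows A i (restrict \<sigma> (move_dom i)) \<pi> \<longleftrightarrow> consistent (own A i) \<sigma> \<pi>"
  using prefix_in_move_dom[OF assms] by (auto simp: follows_def consistent_def)

lemma strategies_nonempty: "\<exists>\<sigma>. \<sigma> \<in> strategies A i"
  using restrict_in_strategies[of i "\<lambda>h. SOME y. (last h, y) \<in> edges A"]
    some_successor[OF total_graph_edges last_history_in_verts] unfolding move_dom_def by blast

text \<open>Badness asks for a lim inf of at most \<open>c\<close> for Player 0, while determinacy
  is applied to the lim sup, a harder objective for Player 1. So it is only the lim sup objective
  that gets refuted; compactness, which needs good times only infinitely often, turns this into a
  gap for the lim inf.\<close>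

lemma gap_of_not_bad:
  assumes u: "u \<in> verts A" and nb: "\<not> bad A c d u"
  shows "\<exists>F \<delta>. F \<subseteq> edges A \<and> total_graph (verts A) F \<and>
     (\<forall>e\<in>edges A. fst e \<in> own A P1 \<longrightarrow> e \<in> F) \<and> \<delta> > 0 \<and>
     (\<forall>\<rho>\<in>runs F. \<rho> 0 = u \<longrightarrow> \<not> (MP A P0 \<rho> \<le> ereal (c + \<delta>) \<and> ereal (d - \<delta>) \<le> MP A P1 \<rho>))"
proof -
  define f g where "f = (\<lambda>e. real_wt A P1 e - d)" and "g = (\<lambda>e. c - real_wt A P0 e)"
  have "\<not> forces (own A P1) (edges A) {f, g} u"
  proof
    assume "forces (own A P1) (edges A) {f, g} u"
    then obtain \<sigma> where leg: "legal (own A P1) (edges A) \<sigma>"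
      and win: "\<And>\<pi>. \<pi> \<in> plays A \<Longrightarrow> \<pi> 0 = u \<Longrightarrow> consistent (own A P1) \<sigma> \<pi> \<Longrightarrow> all_mean_ge0 {f, g} \<pi>"
      unfolding forces_def plays_runs by blast
    define \<sigma>1 where "\<sigma>1 = restrict \<sigma> (move_dom P1)"
    have \<sigma>1: "\<sigma>1 \<in> strategies A P1" unfolding \<sigma>1_def
      using legalD[OF leg] by (intro restrict_in_strategies) (simp add: move_dom_def)
    have "MP A P0 (Out A u \<sigma>0 \<sigma>1) \<le> ereal c \<and> ereal d \<le> MP A P1 (Out A u \<sigma>0 \<sigma>1)"
      if \<sigma>0: "\<sigma>0 \<in> strategies A P0" for \<sigma>0
    proof -
      note O = Out_props[OF u \<sigma>0 \<sigma>1]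
      have "all_mean_ge0 {f, g} (Out A u \<sigma>0 \<sigma>1)"
        using win[OF O(1,2)] O(4) unfolding \<sigma>1_def follows_restrict[OF O(1)[unfolded \<sigma>1_def]] by blast
      then show ?thesis
        using MP_leI[of c A P0 "Out A u \<sigma>0 \<sigma>1"] le_MP_iff[of d A P1 "Out A u \<sigma>0 \<sigma>1"]
        by (simp add: all_mean_ge0_def f_def g_def)
    qed
    then show False using nb \<sigma>1 unfolding bad_def Lambda_def by blast
  qed
  then have "refutes (verts A) (own A P1) (edges A) {f, g} u"
    using forces_or_refutes[OF total_graph_edges own_subset u] by blast
  then obtain F where F: "F \<subseteq> edges A" "total_graph (verts A) F"
    "\<And>e. e \<in> edges A \<Longrightarrow> fst e \<in> own A P1 \<Longrightarrow> e \<in> F"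
    and lose: "\<And>\<pi>. \<pi> \<in> runs F \<Longrightarrow> \<pi> 0 = u \<Longrightarrow> \<not> all_mean_ge0 {f, g} \<pi>"
    unfolding refutes_def by blast
  have "\<exists>\<delta>>0. \<forall>\<rho>\<in>runs F. \<rho> 0 = u \<longrightarrow>
      \<not> (MP A P0 \<rho> \<le> ereal (c + \<delta>) \<and> ereal (d - \<delta>) \<le> MP A P1 \<rho>)"
  proof (rule ccontr)
    assume "\<not> ?thesis"
    then have no: "\<exists>\<rho>\<in>runs F. \<rho> 0 = u \<and> MP A P0 \<rho> \<le> ereal (c + \<delta>) \<and> ereal (d - \<delta>) \<le> MP A P1 \<rho>"
      if "\<delta> > 0" for \<delta>
      using that by blast
    obtain B where B: "\<And>i e. e \<in> edges A \<Longrightarrow> \<bar>real_wt A i e\<bar> \<le> B" using weight_bound by blast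
    have "\<exists>\<rho>\<in>runs F. \<rho> 0 = u \<and> all_mean_ge0 {f, g} \<rho>"
    proof (rule ex_obj_run_of_approximations[OF F(2) u])
      fix h e assume "h \<in> {f, g}" "e \<in> F"
      then show "\<bar>h e\<bar> \<le> B + \<bar>c\<bar> + \<bar>d\<bar>"
        using B[of e P0] B[of e P1] F(1) unfolding f_def g_def by auto
    next
      fix r :: real assume r: "r > 0"
      \<comment> \<open>Three shares: for the shifted thresholds, for the error of the mean, and for
        \<open>C\<close>, which is at most \<open>t * k\<close> beyond \<open>N\<close>.\<close>
      define t where "t = r / 3"
      have t: "t > 0" using r by (simp add: t_def)
      obtain \<rho> where \<rho>: "\<rho> \<in> runs F" "\<rho> 0 = u" "MP A P0 \<rho> \<le> ereal (c + t)" "ereal (d - t) \<le> MP A P1 \<rho>"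
        using no[OF t] by blast
      obtain C where C: "\<And>k. - C - t * real k \<le> psum (\<lambda>e. real_wt A P1 e - (d - t)) \<rho> k"
        using \<rho>(4) t unfolding le_MP_iff mean_ge0_def by blast
      obtain N :: nat where N: "C / t \<le> real N" using real_arch_simple by blast
      have "infinite ({k. - t * real k \<le> psum (\<lambda>e. c + t - real_wt A P0 e) \<rho> k} - {..N})"
        using infinite_MP_le[OF \<rho>(3) t] by simp
      moreover have "k \<in> {k. \<forall>h\<in>{f, g}. - r * real k \<le> psum h \<rho> k}"
        if "k \<in> {k. - t * real k \<le> psum (\<lambda>e. c + t - real_wt A P0 e) \<rho> k} - {..N}" for k
      proof -
        have k: "- t * real k \<le> psum (\<lambda>e. c + t - real_wt A P0 e) \<rho> k" "real N < real k"
          using that by auto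
        have "C / t \<le> real k" using N k(2) by linarith
        then have "C \<le> t * real k" using t by (simp add: field_simps)
        moreover have "r * real k = 3 * (t * real k)" by (simp add: t_def)
        moreover have "0 \<le> t * real k" using t by simp
        moreover note C[of k] k(1)
        ultimately have "- r * real k \<le> psum f \<rho> k" "- r * real k \<le> psum g \<rho> k"
          unfolding f_def g_def psum_minus_const psum_const_minus distrib_right left_diff_distrib
          by linarith+
        then show ?thesis by simp
      qed
      ultimately have "infinite {k. \<forall>h\<in>{f, g}. - r * real k \<le> psum h \<rho> k}"
        by (meson infinite_super subsetI)
      then show "\<exists>\<rho>\<in>runs F. \<rho> 0 = u \<and> infinite {k. \<forall>h\<in>{f, g}. - r * real k \<le> psum h \<rho> k}"
        using \<rho> by blast
    qed
    then show False using lose by blast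
  qed
  then show ?thesis using F by blast
qed

text \<open>The supremum over responses is finite, so from each vertex it can be approached up to
  \<open>\<epsilon>\<close>. A best response must work from all vertices at once; as a history shows
  its first vertex, the responses can be glued.\<close>

lemma BR1_nonempty:
  assumes \<sigma>0: "\<sigma>0 \<in> strategies A P0" and e: "\<epsilon> > 0"
  shows "BR1 A \<epsilon> \<sigma>0 \<noteq> {}"
proof -
  obtain B where B: "\<And>\<pi> i. \<pi> \<in> plays A \<Longrightarrow> ereal (- B) \<le> MP A i \<pi> \<and> MP A i \<pi> \<le> ereal B"
    using MP_bounded by blast
  have near: "\<exists>\<tau>\<in>strategies A P1. \<forall>\<sigma>'\<in>strategies A P1.
      MP A P1 (Out A u \<sigma>0 \<sigma>') - ereal \<epsilon> \<le> MP A P1 (Out A u \<sigma>0 \<tau>)" if u: "u \<in> verts A" for u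
  proof -
    define s where "s = (SUP \<sigma>'\<in>strategies A P1. MP A P1 (Out A u \<sigma>0 \<sigma>'))"
    have up: "MP A P1 (Out A u \<sigma>0 \<sigma>') \<le> s" if "\<sigma>' \<in> strategies A P1" for \<sigma>'
      unfolding s_def using that by (rule SUP_upper)
    obtain \<tau> where \<tau>: "\<tau> \<in> strategies A P1" using strategies_nonempty by blast
    have "s \<le> ereal B" unfolding s_def using B Out_props(1)[OF u \<sigma>0] by (intro SUP_least) blast
    moreover have "ereal (- B) \<le> s" using up[OF \<tau>] B Out_props(1)[OF u \<sigma>0 \<tau>] order_trans by blast
    ultimately obtain r where r: "s = ereal r" by (cases s) auto
    then have "ereal (r - \<epsilon>) < s" using e by simp
    then obtain \<tau> where \<tau>: "\<tau> \<in> strategies A P1" "ereal (r - \<epsilon>) < MP A P1 (Out A u \<sigma>0 \<tau>)"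
      unfolding s_def less_SUP_iff by blast
    have "MP A P1 (Out A u \<sigma>0 \<sigma>') - ereal \<epsilon> \<le> MP A P1 (Out A u \<sigma>0 \<tau>)"
      if "\<sigma>' \<in> strategies A P1" for \<sigma>'
    proof -
      have "MP A P1 (Out A u \<sigma>0 \<sigma>') - ereal \<epsilon> \<le> ereal r - ereal \<epsilon>"
        using up[OF that] r by (intro ereal_minus_mono) auto
      also have "\<dots> \<le> MP A P1 (Out A u \<sigma>0 \<tau>)" using \<tau>(2) by simp
      finally show ?thesis .
    qed
    then show ?thesis using \<tau>(1) by blast
  qed
  \<comment> \<open>Outside \<open>verts A\<close> any strategy is the default, so that
    \<open>\<tau> u\<close> is a strategy for every \<open>u\<close>.\<close>
  have "\<forall>u. \<exists>\<tau>\<in>strategies A P1. u \<in> verts A \<longrightarrow> (\<forall>\<sigma>'\<in>strategies A P1.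
      MP A P1 (Out A u \<sigma>0 \<sigma>') - ereal \<epsilon> \<le> MP A P1 (Out A u \<sigma>0 \<tau>))"
    using near strategies_nonempty by metis
  then obtain \<tau> where \<tau>: "\<And>u. \<tau> u \<in> strategies A P1"
    and best: "\<And>u \<sigma>'. u \<in> verts A \<Longrightarrow> \<sigma>' \<in> strategies A P1 \<Longrightarrow>
      MP A P1 (Out A u \<sigma>0 \<sigma>') - ereal \<epsilon> \<le> MP A P1 (Out A u \<sigma>0 (\<tau> u))"
    by metis
  define \<sigma>1 where "\<sigma>1 = (\<lambda>h. \<tau> (hd h) h)"
  have \<sigma>1: "\<sigma>1 \<in> strategies A P1"
    using \<tau> unfolding \<sigma>1_def strategies_dom by (auto simp: PiE_iff extensional_def)
  have "Out A u \<sigma>0 \<sigma>1 = Out A u \<sigma>0 (\<tau> u)" if u: "u \<in> verts A" for u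
    using Out_props[OF u \<sigma>0 \<tau>[of u]]
    by (intro Out_eqI[OF u \<sigma>0 \<sigma>1]) (auto simp: follows_def \<sigma>1_def)
  then have "\<sigma>1 \<in> BR1 A \<epsilon> \<sigma>0" unfolding BR1_def using \<sigma>1 best by simp
  then show ?thesis by blast
qed

section \<open>From a witness to a value above \<open>c\<close>\<close>

definition track :: "player \<Rightarrow> (nat \<Rightarrow> 'v) \<Rightarrow> ('v list \<Rightarrow> 'v) \<Rightarrow> 'v list \<Rightarrow> 'v" where
  "track i \<pi> fb = restrict
     (\<lambda>h. if h = prefix_upto \<pi> (length h - 1) then \<pi> (length h) else fb h) (move_dom i)"

lemma track_in_strategies:
  assumes "\<pi> \<in> plays A" and "\<And>h. h \<in> move_dom i \<Longrightarrow> (last h, fb h) \<in> edges A"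
  shows "track i \<pi> fb \<in> strategies A i"
  unfolding track_def
proof (rule restrict_in_strategies)
  fix h assume h: "h \<in> move_dom i"
  then have "h \<noteq> []" by (auto simp: move_dom_def histories_def)
  \<comment> \<open>A history with \<open>length h\<close> vertices ends at index
    \<open>length h - 1\<close>, so the next vertex is \<open>\<pi> (length h)\<close>.\<close>
  then have l: "length h = Suc (length h - 1)" by simp
  have "(last h, \<pi> (length h)) \<in> edges A" if "h = prefix_upto \<pi> (length h - 1)"
    using assms(1) that l last_prefix_upto unfolding plays_def by (metis (mono_tags, lifting) mem_Collect_eq)
  then show "(last h, if h = prefix_upto \<pi> (length h - 1) then \<pi> (length h) else fb h) \<in> edges A"
    using assms(2)[OF h] by simp
qed

lemma follows_track_self:
  assumes "\<pi> \<in> plays A"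
  shows "follows A i (track i \<pi> fb) \<pi>"
  unfolding track_def follows_restrict[OF assms] by (simp add: consistent_def)

text \<open>Near-optimality obliges Player 1 to secure at least \<open>d - \<delta>\<close>, since
  following \<open>\<pi>\<close> is possible and yields \<open>d\<close>. Either
  \<open>\<pi>\<close> is followed and Player 0 gets \<open>c'\<close>, or it is left and the gap at
  the vertex of departure gives Player 0 more than \<open>c + \<delta>\<close>.\<close>

lemma ASV_greater_of_witness:
  assumes \<pi>: "\<pi> \<in> plays A" and w: "witness A v c \<pi>"
  shows "ereal c < ASV A v"
proof -
  from w obtain c' d where v: "\<pi> 0 = v" and mp: "MP A P0 \<pi> = ereal c'" "MP A P1 \<pi> = ereal d"
    and c': "c' > c" and nb: "\<And>k. \<not> bad A c d (\<pi> k)"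
    unfolding witness_def cd_witness_def by blast
  define gap where "gap = (\<lambda>z F \<delta>. F \<subseteq> edges A \<and> total_graph (verts A) F \<and>
     (\<forall>e\<in>edges A. fst e \<in> own A P1 \<longrightarrow> e \<in> F) \<and> \<delta> > 0 \<and>
     (\<forall>\<rho>\<in>runs F. \<rho> 0 = z \<longrightarrow> \<not> (MP A P0 \<rho> \<le> ereal (c + \<delta>) \<and> ereal (d - \<delta>) \<le> MP A P1 \<rho>)))"
  have "\<forall>z. \<exists>F \<delta>. z \<in> range \<pi> \<longrightarrow> gap z F \<delta>"
  proof
    fix z
    show "\<exists>F \<delta>. z \<in> range \<pi> \<longrightarrow> gap z F \<delta>"
    proof (cases "z \<in> range \<pi>")
      case True
      then obtain k where "z = \<pi> k" by blast
      then show ?thesis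
        using gap_of_not_bad[OF play_in_verts[OF \<pi>, of k] nb[of k]] unfolding gap_def by blast
    qed blast
  qed
  then obtain F \<Delta> where "\<forall>z. z \<in> range \<pi> \<longrightarrow> gap z (F z) (\<Delta> z)" by metis
  then have gap: "gap (\<pi> k) (F (\<pi> k)) (\<Delta> (\<pi> k))" for k by blast
  have fin: "finite (\<Delta> ` range \<pi>)"
    using play_in_verts[OF \<pi>] by (intro finite_imageI finite_subset[OF _ finite_verts]) auto
  define \<delta> where "\<delta> = Min (\<Delta> ` range \<pi>)"
  have \<delta>: "\<delta> > 0" unfolding \<delta>_def using fin gap by (subst Min_gr_iff) (auto simp: gap_def)
  have \<delta>_le: "\<delta> \<le> \<Delta> (\<pi> k)" for k unfolding \<delta>_def using fin by (intro Min_le) auto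
  have lose: "\<not> (MP A P0 \<rho> \<le> ereal (c + \<delta>) \<and> ereal (d - \<delta>) \<le> MP A P1 \<rho>)"
    if "\<rho> \<in> runs (F (\<pi> k))" "\<rho> 0 = \<pi> k" for \<rho> k
  proof
    assume "MP A P0 \<rho> \<le> ereal (c + \<delta>) \<and> ereal (d - \<delta>) \<le> MP A P1 \<rho>"
    moreover have "ereal (c + \<delta>) \<le> ereal (c + \<Delta> (\<pi> k))" "ereal (d - \<Delta> (\<pi> k)) \<le> ereal (d - \<delta>)"
      using \<delta>_le[of k] by auto
    ultimately have "MP A P0 \<rho> \<le> ereal (c + \<Delta> (\<pi> k)) \<and> ereal (d - \<Delta> (\<pi> k)) \<le> MP A P1 \<rho>"
      by (meson order_trans)
    then show False using gap[of k] that unfolding gap_def by blast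
  qed
  \<comment> \<open>The first wrong vertex has index \<open>dev h\<close>; the departure was chosen
    one step earlier, at \<open>\<pi> (dev h - 1)\<close>.\<close>
  define dev where "dev = (\<lambda>h. LEAST i. i < length h \<and> h ! i \<noteq> \<pi> i)"
  define \<sigma>0 where "\<sigma>0 = track P0 \<pi> (\<lambda>h. SOME y. (last h, y) \<in> F (\<pi> (dev h - 1)))"
  have \<sigma>0: "\<sigma>0 \<in> strategies A P0" unfolding \<sigma>0_def
  proof (rule track_in_strategies[OF \<pi>])
    fix h assume "h \<in> move_dom P0"
    then have l: "last h \<in> verts A" unfolding move_dom_def using last_history_in_verts by blast
    have F: "total_graph (verts A) (F (\<pi> (dev h - 1)))" "F (\<pi> (dev h - 1)) \<subseteq> edges A"
      using gap[of "dev h - 1"] by (simp_all add: gap_def)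
    show "(last h, SOME y. (last h, y) \<in> F (\<pi> (dev h - 1))) \<in> edges A"
      using some_successor[OF F(1) l] F(2) by (rule subsetD[rotated])
  qed
  define \<sigma>\<pi> where "\<sigma>\<pi> = track P1 \<pi> (\<lambda>h. SOME y. (last h, y) \<in> edges A)"
  have \<sigma>\<pi>: "\<sigma>\<pi> \<in> strategies A P1" unfolding \<sigma>\<pi>_def
    using some_successor[OF total_graph_edges last_history_in_verts]
    by (intro track_in_strategies[OF \<pi>]) (simp add: move_dom_def)
  have vV: "v \<in> verts A" using play_in_verts[OF \<pi>, of 0] v by simp
  have out\<pi>: "Out A v \<sigma>0 \<sigma>\<pi> = \<pi>"
    by (rule Out_eqI[OF vV \<sigma>0 \<sigma>\<pi> \<pi> v]) (simp_all add: \<sigma>0_def \<sigma>\<pi>_def follows_track_self[OF \<pi>])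
  define \<eta> where "\<eta> = min \<delta> (c' - c)"
  have \<eta>: "\<eta> > 0" using \<delta> c' by (simp add: \<eta>_def)
  have val: "ereal (c + \<eta>) \<le> MP A P0 (Out A v \<sigma>0 \<sigma>1)" if \<sigma>1: "\<sigma>1 \<in> BR1 A \<delta> \<sigma>0" for \<sigma>1
  proof -
    have s1: "\<sigma>1 \<in> strategies A P1" using \<sigma>1 by (simp add: BR1_def)
    define \<rho> where "\<rho> = Out A v \<sigma>0 \<sigma>1"
    note O = Out_props[OF vV \<sigma>0 s1, folded \<rho>_def]
    have "MP A P1 (Out A v \<sigma>0 \<sigma>\<pi>) - ereal \<delta> \<le> MP A P1 \<rho>"
      using \<sigma>1 vV \<sigma>\<pi> unfolding BR1_def \<rho>_def by blast
    then have near: "ereal (d - \<delta>) \<le> MP A P1 \<rho>" by (simp add: out\<pi> mp)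
    show ?thesis
    proof (cases "\<rho> = \<pi>")
      case True
      then show ?thesis using mp by (simp add: \<eta>_def flip: \<rho>_def)
    next
      case False
      then have ex: "\<exists>i. \<rho> i \<noteq> \<pi> i" by blast
      define n where "n = (LEAST i. \<rho> i \<noteq> \<pi> i)"
      have n: "\<rho> n \<noteq> \<pi> n" unfolding n_def using ex by (rule LeastI_ex)
      have before: "\<rho> i = \<pi> i" if "i < n" for i
        using that not_less_Least[of i "\<lambda>i. \<rho> i \<noteq> \<pi> i"] unfolding n_def by blast
      have "n \<noteq> 0" using n O(2) v by (intro notI) simp
      then obtain k where k: "n = Suc k" using not0_implies_Suc by blast
      have \<sigma>0_follow: "\<rho> (Suc j) = (if prefix_upto \<rho> j = prefix_upto \<pi> j then \<pi> (Suc j)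
          else SOME y. (\<rho> j, y) \<in> F (\<pi> (dev (prefix_upto \<rho> j) - 1)))" if "\<rho> j \<in> own A P0" for j
        using O(3) that unfolding \<sigma>0_def track_def follows_restrict[OF O(1)] consistent_def
        by (simp add: last_prefix_upto)
      \<comment> \<open>Player 0 stays on \<open>\<pi>\<close> as long as the history agrees with
        it. So the departing edge is Player 1's, and \<open>F (\<pi> k)\<close> contains all of
        those.\<close>
      have "\<rho> k \<notin> own A P0"
      proof
        assume P: "\<rho> k \<in> own A P0"
        have "prefix_upto \<rho> k = prefix_upto \<pi> k" using before k by (intro prefix_upto_cong) simp
        then show False using \<sigma>0_follow[OF P] n k by simp
      qed
      have edge: "(\<rho> j, \<rho> (Suc j)) \<in> F (\<pi> k)" if j: "j \<ge> k" for j
      proof (cases "\<rho> j \<in> own A P0")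
        case False
        then have "\<rho> j \<in> own A P1" using play_in_verts[OF O(1)] own_Un by blast
        moreover have "(\<rho> j, \<rho> (Suc j)) \<in> edges A" using O(1) by (simp add: plays_def)
        ultimately show ?thesis using gap[of k] unfolding gap_def by force
      next
        case True
        then have "j \<noteq> k" using \<open>\<rho> k \<notin> own A P0\<close> by blast
        then have jn: "n \<le> j" using j k by simp
        then have ne: "prefix_upto \<rho> j \<noteq> prefix_upto \<pi> j"
          using n by (metis nth_prefix_upto)
        have "dev (prefix_upto \<rho> j) = n" unfolding dev_def
        proof (rule Least_equality)
          show "n < length (prefix_upto \<rho> j) \<and> prefix_upto \<rho> j ! n \<noteq> \<pi> n" using jn n by simp
          show "n \<le> i" if "i < length (prefix_upto \<rho> j) \<and> prefix_upto \<rho> j ! i \<noteq> \<pi> i" for i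
            using that before[of i] by (simp add: not_less[symmetric]) (metis nth_prefix_upto not_less_eq_eq not_le)
        qed
        then have "\<rho> (Suc j) = (SOME y. (\<rho> j, y) \<in> F (\<pi> k))"
          using \<sigma>0_follow[OF True] ne k by simp
        then show ?thesis
          using some_successor[of "verts A" "F (\<pi> k)" "\<rho> j"] gap[of k] play_in_verts[OF O(1)]
          unfolding gap_def by simp
      qed
      have "(\<lambda>j. \<rho> (k + j)) \<in> runs (F (\<pi> k))" using edge by (simp add: runs_def)
      then have "\<not> (MP A P0 \<rho> \<le> ereal (c + \<delta>) \<and> ereal (d - \<delta>) \<le> MP A P1 \<rho>)"
        using lose[of "\<lambda>j. \<rho> (k + j)" k] before[of k] k by (simp add: MP_shift[of A _ \<rho> k])
      then have "ereal (c + \<delta>) \<le> MP A P0 \<rho>" using near by auto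
      moreover have "ereal (c + \<eta>) \<le> ereal (c + \<delta>)" by (simp add: \<eta>_def)
      ultimately show ?thesis unfolding \<rho>_def by (rule order_trans[rotated])
    qed
  qed
  have "ereal c < ereal (c + \<eta>)" using \<eta> by simp
  also have "\<dots> \<le> (INF \<sigma>1 \<in> BR1 A \<delta> \<sigma>0. MP A P0 (Out A v \<sigma>0 \<sigma>1))"
    using val by (rule INF_greatest)
  also have "\<dots> \<le> ASV_strat A \<sigma>0 v" unfolding ASV_strat_def
    using \<delta> BR1_nonempty[OF \<sigma>0 \<delta>] by (intro SUP_upper) simp
  also have "\<dots> \<le> ASV A v" unfolding ASV_def using \<sigma>0 by (rule SUP_upper)
  finally show ?thesis .
qed

section \<open>From a value above \<open>c\<close> to a witness\<close>

definition splice :: "nat \<Rightarrow> (nat \<Rightarrow> 'v) \<Rightarrow> (nat \<Rightarrow> 'v) \<Rightarrow> nat \<Rightarrow> 'v" where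
  "splice k \<pi> \<rho> j = (if j < k then \<pi> j else \<rho> (j - k))"

lemma splice_play:
  assumes "\<pi> \<in> plays A" "\<rho> \<in> plays A" "\<rho> 0 = \<pi> k"
  shows "splice k \<pi> \<rho> \<in> plays A"
proof -
  have "(splice k \<pi> \<rho> j, splice k \<pi> \<rho> (Suc j)) \<in> edges A" for j
  proof -
    consider "Suc j < k" | "Suc j = k" | "j \<ge> k" by linarith
    then show ?thesis
      using assms by cases (auto simp: splice_def plays_def Suc_diff_le)
  qed
  then show ?thesis by (simp add: plays_def)
qed

lemma prefix_upto_splice:
  "prefix_upto (splice k \<pi> \<rho>) (k + n) = map \<pi> [0..<k] @ prefix_upto \<rho> n"
  by (rule nth_equalityI) (auto simp: nth_append splice_def)

text \<open>The forcing strategy is used only after exactly the prefix of \<open>\<pi>\<close> up to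
  \<open>k\<close>. That prefix starts in \<open>v\<close>, so outcomes from other vertices are
  unchanged; this matters because being a best response is a condition on all start
  vertices.\<close>

lemma deviation_to_bad_vertex:
  assumes \<sigma>0: "\<sigma>0 \<in> strategies A P0" and \<sigma>1: "\<sigma>1 \<in> strategies A P1" and v: "v \<in> verts A"
    and \<pi>_def: "\<pi> = Out A v \<sigma>0 \<sigma>1" and bad: "bad A c d (\<pi> k)"
  shows "\<exists>\<sigma>\<in>strategies A P1. MP A P0 (Out A v \<sigma>0 \<sigma>) \<le> ereal c \<and> ereal d \<le> MP A P1 (Out A v \<sigma>0 \<sigma>) \<and>
    (\<forall>u\<in>verts A. u \<noteq> v \<longrightarrow> Out A u \<sigma>0 \<sigma> = Out A u \<sigma>0 \<sigma>1)"
proof -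
  note O = Out_props[OF v \<sigma>0 \<sigma>1, folded \<pi>_def]
  from bad obtain \<tau>1 where \<tau>1: "\<tau>1 \<in> strategies A P1"
    and force: "\<And>\<tau>0. \<tau>0 \<in> strategies A P0 \<Longrightarrow>
      MP A P0 (Out A (\<pi> k) \<tau>0 \<tau>1) \<le> ereal c \<and> ereal d \<le> MP A P1 (Out A (\<pi> k) \<tau>0 \<tau>1)"
    unfolding bad_def Lambda_def by blast
  have legS: "(last h, \<sigma> h) \<in> edges A" if "\<sigma> \<in> strategies A i" "h \<in> move_dom i" for \<sigma> i h
    using that by (auto simp: strategies_dom PiE_iff)
  \<comment> \<open>Badness concerns plays starting in \<open>\<pi> k\<close>, so
    \<open>\<sigma>0\<close> is relocated there by putting the first \<open>k\<close> vertices of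
    \<open>\<pi>\<close> back in front.\<close>
  define \<tau>0 where "\<tau>0 = restrict (\<lambda>h. if hd h = \<pi> k then \<sigma>0 (map \<pi> [0..<k] @ h) else \<sigma>0 h) (move_dom P0)"
  have \<tau>0: "\<tau>0 \<in> strategies A P0" unfolding \<tau>0_def
  proof (rule restrict_in_strategies)
    fix h assume h: "h \<in> move_dom P0"
    then obtain \<rho> n where \<rho>: "\<rho> \<in> plays A" "h = prefix_upto \<rho> n"
      unfolding move_dom_def histories_def by blast
    have "(last h, \<sigma>0 (map \<pi> [0..<k] @ h)) \<in> edges A" if "hd h = \<pi> k"
    proof -
      have "map \<pi> [0..<k] @ h = prefix_upto (splice k \<pi> \<rho>) (k + n)"
        by (simp add: prefix_upto_splice \<rho>)
      moreover have "splice k \<pi> \<rho> \<in> plays A" using that \<rho> O(1) by (intro splice_play) simp_all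
      moreover have "last (map \<pi> [0..<k] @ h) = last h" using \<rho> by simp
      ultimately have "map \<pi> [0..<k] @ h \<in> move_dom P0"
        using h prefix_in_histories by (simp add: move_dom_def)
      then show ?thesis using legS[OF \<sigma>0] \<open>last (map \<pi> [0..<k] @ h) = last h\<close> by metis
    qed
    then show "(last h, if hd h = \<pi> k then \<sigma>0 (map \<pi> [0..<k] @ h) else \<sigma>0 h) \<in> edges A"
      using legS[OF \<sigma>0 h] by simp
  qed
  \<comment> \<open>After the prefix, \<open>drop k h\<close> keeps \<open>\<pi> k\<close> as the
    first vertex of the history handed to \<open>\<tau>1\<close>.\<close>
  define \<sigma> where "\<sigma> = restrict
    (\<lambda>h. if k < length h \<and> take (Suc k) h = prefix_upto \<pi> k then \<tau>1 (drop k h) else \<sigma>1 h) (move_dom P1)"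
  have \<sigma>: "\<sigma> \<in> strategies A P1" unfolding \<sigma>_def
  proof (rule restrict_in_strategies)
    fix h assume h: "h \<in> move_dom P1"
    then obtain \<rho> n where \<rho>: "\<rho> \<in> plays A" "h = prefix_upto \<rho> n"
      unfolding move_dom_def histories_def by blast
    have "(last h, \<tau>1 (drop k h)) \<in> edges A" if "k < length h"
    proof -
      have "drop k h = prefix_upto (\<lambda>j. \<rho> (k + j)) (n - k)"
        using that \<rho> by (intro nth_equalityI) auto
      moreover have "(\<lambda>j. \<rho> (k + j)) \<in> plays A" using \<rho> by (simp add: plays_def)
      ultimately have "drop k h \<in> histories A" using prefix_in_histories by metis
      moreover have l: "last (drop k h) = last h" using that by simp
      ultimately have "drop k h \<in> move_dom P1" using h by (simp add: move_dom_def)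
      then show ?thesis using legS[OF \<tau>1] l by metis
    qed
    then show "(last h, if k < length h \<and> take (Suc k) h = prefix_upto \<pi> k then \<tau>1 (drop k h) else \<sigma>1 h) \<in> edges A"
      using legS[OF \<sigma>1 h] by simp
  qed
  define \<rho> where "\<rho> = Out A (\<pi> k) \<tau>0 \<tau>1"
  note R = Out_props[OF play_in_verts[OF O(1), of k] \<tau>0 \<tau>1, folded \<rho>_def]
  define \<theta> where "\<theta> = splice k \<pi> \<rho>"
  have \<theta>: "\<theta> \<in> plays A" unfolding \<theta>_def using O(1) R(1,2) by (rule splice_play)
  have \<theta>_le: "\<theta> j = \<pi> j" if "j \<le> k" for j
    using that R(2) by (cases "j = k") (auto simp: \<theta>_def splice_def)
  have \<theta>_ge: "\<theta> (k + j) = \<rho> j" for j by (simp add: \<theta>_def splice_def)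
  have pre: "prefix_upto \<theta> j = prefix_upto \<pi> j" if "j \<le> k" for j
    using that \<theta>_le by (intro prefix_upto_cong) simp
  have pre2: "prefix_upto \<theta> (k + j) = map \<pi> [0..<k] @ prefix_upto \<rho> j" for j
    by (simp add: \<theta>_def prefix_upto_splice)
  have "\<theta> (Suc j) = \<sigma>0 (prefix_upto \<theta> j)" if j: "\<theta> j \<in> own A P0" for j
  proof (cases "j < k")
    case True
    then show ?thesis using O(3) j \<theta>_le[of j] \<theta>_le[of "Suc j"] pre[of j] by (simp add: follows_def)
  next
    case False
    then obtain i where i: "j = k + i" using le_Suc_ex not_less by blast
    have \<rho>i: "\<rho> i \<in> own A P0" using j \<theta>_ge[of i] i by simp
    have "\<theta> (Suc j) = \<tau>0 (prefix_upto \<rho> i)"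
      using R(3) \<rho>i \<theta>_ge[of "Suc i"] i by (simp add: follows_def)
    also have "\<dots> = \<sigma>0 (prefix_upto \<theta> j)"
      using prefix_in_move_dom[OF R(1) \<rho>i] R(2) by (simp add: \<tau>0_def pre2 i)
    finally show ?thesis .
  qed
  then have f0: "follows A P0 \<sigma>0 \<theta>" by (simp add: follows_def)
  have "\<theta> (Suc j) = \<sigma> (prefix_upto \<theta> j)" if j: "\<theta> j \<in> own A P1" for j
  proof (cases "j < k")
    case True
    then have "\<sigma> (prefix_upto \<theta> j) = \<sigma>1 (prefix_upto \<pi> j)"
      using prefix_in_move_dom[OF \<theta> j] pre[of j] by (simp add: \<sigma>_def)
    then show ?thesis using True O(4) j \<theta>_le[of j] \<theta>_le[of "Suc j"] by (simp add: follows_def)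
  next
    case False
    then obtain i where i: "j = k + i" using le_Suc_ex not_less by blast
    have \<rho>i: "\<rho> i \<in> own A P1" using j \<theta>_ge[of i] i by simp
    have "take (Suc k) (prefix_upto \<theta> j) = prefix_upto \<pi> k"
      using take_prefix_upto[of k j \<theta>] pre[of k] i by simp
    moreover have "drop k (prefix_upto \<theta> j) = prefix_upto \<rho> i" by (simp add: i pre2)
    moreover have "k < length (prefix_upto \<theta> j)" by (simp add: i)
    ultimately have "\<sigma> (prefix_upto \<theta> j) = \<tau>1 (prefix_upto \<rho> i)"
      using prefix_in_move_dom[OF \<theta> j] by (simp add: \<sigma>_def)
    then show ?thesis using R(4) \<rho>i \<theta>_ge[of "Suc i"] i by (simp add: follows_def)
  qed
  then have f1: "follows A P1 \<sigma> \<theta>" by (simp add: follows_def)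
  have out: "Out A v \<sigma>0 \<sigma> = \<theta>"
    using \<theta>_le[of 0] O(2) by (intro Out_eqI[OF v \<sigma>0 \<sigma> \<theta> _ f0 f1]) simp
  have MPeq: "MP A i \<theta> = MP A i \<rho>" for i
    using MP_shift[of A i \<theta> k] \<theta>_ge by simp
  have "Out A u \<sigma>0 \<sigma> = Out A u \<sigma>0 \<sigma>1" if u: "u \<in> verts A" "u \<noteq> v" for u
  proof -
    note Q = Out_props[OF u(1) \<sigma>0 \<sigma>1]
    have "\<sigma> (prefix_upto (Out A u \<sigma>0 \<sigma>1) j) = \<sigma>1 (prefix_upto (Out A u \<sigma>0 \<sigma>1) j)"
      if "Out A u \<sigma>0 \<sigma>1 j \<in> own A P1" for j
    proof -
      have "take (Suc k) (prefix_upto (Out A u \<sigma>0 \<sigma>1) j) \<noteq> prefix_upto \<pi> k"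
      proof
        assume "take (Suc k) (prefix_upto (Out A u \<sigma>0 \<sigma>1) j) = prefix_upto \<pi> k"
        then have "hd (take (Suc k) (prefix_upto (Out A u \<sigma>0 \<sigma>1) j)) = \<pi> 0" by simp
        then show False using Q(2) O(2) u(2) by simp
      qed
      then show ?thesis using prefix_in_move_dom[OF Q(1) that] by (simp add: \<sigma>_def)
    qed
    then show ?thesis
      using Q by (intro Out_eqI[OF u(1) \<sigma>0 \<sigma> Q(1-3)]) (simp add: follows_def)
  qed
  then show ?thesis using \<sigma> out MPeq force[OF \<tau>0] \<rho>_def by metis
qed

text \<open>The two suprema single out \<open>\<sigma>0\<close> and \<open>\<epsilon>\<close> for
  which every \<open>\<epsilon>\<close>-best response yields more than \<open>c\<close>; the outcome
  of any of them is a witness.\<close>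

lemma witness_of_ASV_greater:
  assumes v: "v \<in> verts A" and "ereal c < ASV A v"
  shows "\<exists>\<pi>\<in>plays A. witness A v c \<pi>"
proof -
  obtain \<sigma>0 where \<sigma>0: "\<sigma>0 \<in> strategies A P0" and "ereal c < ASV_strat A \<sigma>0 v"
    using assms(2) unfolding ASV_def less_SUP_iff by blast
  then obtain \<epsilon> where ne: "BR1 A \<epsilon> \<sigma>0 \<noteq> {}"
    and inf: "ereal c < (INF \<sigma>1 \<in> BR1 A \<epsilon> \<sigma>0. MP A P0 (Out A v \<sigma>0 \<sigma>1))"
    unfolding ASV_strat_def less_SUP_iff by blast
  have good: "ereal c < MP A P0 (Out A v \<sigma>0 \<sigma>)" if "\<sigma> \<in> BR1 A \<epsilon> \<sigma>0" for \<sigma>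
    using less_INF_D[OF inf that] .
  obtain \<sigma>1 where BR: "\<sigma>1 \<in> BR1 A \<epsilon> \<sigma>0" using ne by blast
  then have \<sigma>1: "\<sigma>1 \<in> strategies A P1" by (simp add: BR1_def)
  define \<pi> where "\<pi> = Out A v \<sigma>0 \<sigma>1"
  note O = Out_props[OF v \<sigma>0 \<sigma>1, folded \<pi>_def]
  obtain c' d where mp: "MP A P0 \<pi> = ereal c'" "MP A P1 \<pi> = ereal d"
    using MP_real[OF O(1)] by metis
  have "c' > c" using good[OF BR] mp by (simp flip: \<pi>_def)
  moreover have "\<not> bad A c d (\<pi> k)" for k
  proof
    assume "bad A c d (\<pi> k)"
    then obtain \<sigma> where \<sigma>: "\<sigma> \<in> strategies A P1" and le: "MP A P0 (Out A v \<sigma>0 \<sigma>) \<le> ereal c"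
      and ge: "ereal d \<le> MP A P1 (Out A v \<sigma>0 \<sigma>)"
      and same: "\<And>u. u \<in> verts A \<Longrightarrow> u \<noteq> v \<Longrightarrow> Out A u \<sigma>0 \<sigma> = Out A u \<sigma>0 \<sigma>1"
      using deviation_to_bad_vertex[OF \<sigma>0 \<sigma>1 v \<pi>_def] by blast
    \<comment> \<open>From \<open>v\<close> the deviation yields at least \<open>d\<close>, the
      payoff under \<open>\<sigma>1\<close>; from other vertices the outcome is the same. So it is
      again an \<open>\<epsilon>\<close>-best response.\<close>
    have "MP A P1 (Out A u \<sigma>0 \<sigma>') - ereal \<epsilon> \<le> MP A P1 (Out A u \<sigma>0 \<sigma>)"
      if "u \<in> verts A" "\<sigma>' \<in> strategies A P1" for u \<sigma>'
    proof -
      have "MP A P1 (Out A u \<sigma>0 \<sigma>') - ereal \<epsilon> \<le> MP A P1 (Out A u \<sigma>0 \<sigma>1)"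
        using BR that by (simp add: BR1_def)
      also have "\<dots> \<le> MP A P1 (Out A u \<sigma>0 \<sigma>)"
        using ge mp(2) same[OF that(1)] by (cases "u = v") (simp_all flip: \<pi>_def)
      finally show ?thesis .
    qed
    then have "\<sigma> \<in> BR1 A \<epsilon> \<sigma>0" using \<sigma> by (simp add: BR1_def)
    then show False using good le by (meson leD)
  qed
  ultimately have "cd_witness A c' d v c \<pi>" using O(1,2) mp by (simp add: cd_witness_def)
  then show ?thesis using O(1) unfolding witness_def by blast
qed

end

theorem theorem5:
  fixes A :: "'v arena_data" and v :: 'v and c :: real
  assumes "arena A" and "v \<in> verts A"
  shows "ASV A v > ereal c \<longleftrightarrow> (\<exists>\<pi> \<in> plays A. witness A v c \<pi>)"
  using arena.witness_of_ASV_greater[OF assms] arena.ASV_greater_of_witness[OF assms(1)] by blast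

end
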